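(* Taking the mechanical constraints of the Rubik's Revenge into account, the probability that a uniformly random element of $\mathrm{Rev}_{meca}$ is solvable, i.e. lies in $\mathcal{I}'\cdot x_0\cdot\mathcal{L}$, is $$\frac{\#(\mathcal{I}'\cdot x_0\cdot\mathcal{L})}{\#\mathrm{Rev}_{meca}}=\frac13.$$
   Context: $C_n=\mathbf{Z}/n\mathbf{Z}$; $\mathfrak{S}(X)$ is the group of permutations of a set $X$. Geometric pieces. Model the $4\times4\times4$ cube by the 56 cubies $c\in\{-3,-1,1,3\}^3$ having at least one coordinate equal to $\pm3$. A (geometric) facet is a pair $(c,n)$ with $c$ a cubie and $n\in\{\pm e_1,\pm e_2,\pm e_3\}$ such that $\langle c,n\rangle=3$; put $p(c,n)=c$. $\mathrm{ArGeom}$ (24 edges), $\mathrm{SomGeom}$ (8 corners), $\mathrm{CentGeom}$ (24 centres) are the sets of cubies with exactly two, three, one coordinates equal to $\pm3$. $C_2$ acts on the facets of edges by exchanging the two facets of each edge; the generator of $C_3$ acts on the three facets of each corner $c$ by the direct rotation of angle $2\pi/3$ about the axis oriented from $c$ to the origin. Material pieces. $\mathrm{Coul}=\{\mathrm{Bla},\mathrm{J},\mathrm{Ble},\mathrm{V},\mathrm{O},\mathrm{R}\}$, with opposite pairs $\{\mathrm{Bla},\mathrm{J}\},\{\mathrm{Ble},\mathrm{V}\},\{\mathrm{O},\mathrm{R}\}$. $\mathrm{ArMat}$ is the set of pairs $(P,j)$, $P$ one of the 12 pairs of non-opposite distinct colours, $j\in\{1,2\}$; its facets are $(P,j,c)$,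 $c\in P$, and $C_2$ exchanges the two facets of each material edge. $\mathrm{SomMat}$ is the set of the 8 triples of pairwise non-opposite distinct colours, the facets of a triple being its colours, with the generator of $C_3$ acting by the cyclic permutations $[\mathrm{Bla},\mathrm{Ble},\mathrm{R}]$, $[\mathrm{Bla},\mathrm{O},\mathrm{Ble}]$, $[\mathrm{Bla},\mathrm{V},\mathrm{O}]$, $[\mathrm{Bla},\mathrm{R},\mathrm{V}]$, $[\mathrm{J},\mathrm{R},\mathrm{Ble}]$, $[\mathrm{J},\mathrm{Ble},\mathrm{O}]$, $[\mathrm{J},\mathrm{V},\mathrm{R}]$, $[\mathrm{J},\mathrm{O},\mathrm{V}]$ ($[a,b,c]$ meaning $a\mapsto b\mapsto c\mapsto a$). $\mathrm{CentMat}=\mathrm{Coul}\times\{1,2,3,4\}$, each having one facet. Colourings. An isomorphism of $C_k$-bundles between two such sets of pieces is a pair $(f,F)$ with $f$ a bijection of pieces and $F$ a $C_k$-equivariant bijection of facets lying over $f$ (a facet of a piece $a$ is sent to a facet of $f(a)$). $\mathrm{Rev}_{marq}$ is the set of triples $(\mathfrak{f},\mathfrak{g},h)$ where $\mathfrak{f}:\mathrm{ArGeom}\to\mathrm{ArMat}$ is an isomorphism of $C_2$-bundles, $\mathfrak{g}:\mathrm{SomGeom}\to\mathrm{SomMat}$ is an isomorphism of $C_3$-bundles and $h:\mathrm{CentGeom}\to\mathrm{CentMat}$ is a bijection. Let $\mathcal{T}_{geom}=\mathrm{Aut}_{C_2}(\mathrm{ArGeom})\times\mathrm{Aut}_{C_3}(\mathrm{SomGeom})\times\mathfrak{S}(\mathrm{CentGeom})$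 and $\mathcal{T}_{mat}=\mathrm{Aut}_{C_2}(\mathrm{ArMat})\times\mathrm{Aut}_{C_3}(\mathrm{SomMat})\times\mathfrak{S}(\mathrm{CentMat})$ (bundle automorphisms). $\mathcal{T}_{mat}$ acts on the left and $\mathcal{T}_{geom}$ on the right of $\mathrm{Rev}_{marq}$ by composition. Legal moves. For $i\in\{1,2,3\}$ and $v\in\{-3,-1,1,3\}$, the elementary slice move is the permutation of the facets sending $(c,n)$ to $(Rc,Rn)$ if $c_i=v$ and fixing $(c,n)$ otherwise, where $R$ is the rotation by a quarter turn about the axis $e_i$. These 12 moves define elements of $\mathcal{T}_{geom}$; $\mathcal{L}\subset\mathcal{T}_{geom}$ is the subgroup they generate. Indistinguishable transformations. $\mathcal{I}=\mathcal{I}(\mathrm{ArMat})\times\{1\}\times\mathcal{I}(\mathrm{CentMat})\subset\mathcal{T}_{mat}$, where $\mathcal{I}(\mathrm{ArMat})$ is the group of $C_2$-bundle automorphisms of $\mathrm{ArMat}$ whose map on facets preserves the colour of each facet and the colour pair of each edge (i.e. $(P,j,c)\mapsto(P,j',c)$), and $\mathcal{I}(\mathrm{CentMat})$ is the group of permutations of $\mathrm{CentMat}$ preserving the colour. Solved state. Put $\mathrm{col}(e_1)=\mathrm{R}$, $\mathrm{col}(-e_1)=\mathrm{O}$, $\mathrm{col}(e_2)=\mathrm{Ble}$, $\mathrm{col}(-e_2)=\mathrm{V}$, $\mathrm{col}(e_3)=\mathrm{Bla}$, $\mathrm{col}(-e_3)=\mathrm{J}$. The solved state $x_0=(\mathfrak{f},\mathfrak{g},h)\in\mathrm{Rev}_{marq}$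 is a fixed element sending each facet $(c,n)$ to a material facet of colour $\mathrm{col}(n)$. Mechanical constraints. For an edge $c\in\mathrm{ArGeom}$ with facets $(c,n),(c,n')$ and remaining coordinate $c_k=\pm1$, let $s(c)$ be the facet $(c,n)$ for the ordering with $\det(n,n',c_ke_k)>0$. $\mathcal{T}'_{geom}$ is the subgroup of $((\sigma,\Phi),(\tau,\Psi),\phi)\in\mathcal{T}_{geom}$ such that $\Phi(s(\alpha))=s(\sigma(\alpha))$ for all $\alpha\in\mathrm{ArGeom}$ (one has $\mathcal{L}\subset\mathcal{T}'_{geom}$). $\mathrm{Rev}_{meca}=x_0\cdot\mathcal{T}'_{geom}$ and $\mathcal{I}'=\mathcal{I}\cap x_0\mathcal{T}'_{geom}x_0^{-1}$. *)

theory Defs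
  imports
    "HOL-Library.Product_Plus"
    "HOL-Algebra.Bij"
    "HOL-Algebra.Generated_Groups"
    "HOL-Combinatorics.Cycles"
    "HOL-Probability.Probability_Mass_Function"
begin

section \<open>Integer vectors\<close>

type_synonym int3 = "int \<times> int \<times> int"

text \<open>Axes are numbered 1, 2, 3; addition and negation of vectors come from
  \<^theory>\<open>HOL-Library.Product_Plus\<close>.\<close>

definition coord :: "nat \<Rightarrow> int3 \<Rightarrow> int" where
  "coord i = (\<lambda>(x, y, z). if i = 1 then x else if i = 2 then y else z)"

definition axis_vec :: "nat \<Rightarrow> int3" where
  "axis_vec i = (of_bool (i = 1), of_bool (i = 2), of_bool (i = 3))"

definition scale3 :: "int \<Rightarrow> int3 \<Rightarrow> int3" where
  "scale3 k = (\<lambda>(x, y, z). (k * x, k * y, k * z))"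

definition div3 :: "int3 \<Rightarrow> int \<Rightarrow> int3" where
  "div3 v k = (case v of (x, y, z) \<Rightarrow> (x div k, y div k, z div k))"

definition dot3 :: "int3 \<Rightarrow> int3 \<Rightarrow> int" where
  "dot3 = (\<lambda>(x, y, z) (x', y', z'). x * x' + y * y' + z * z')"

definition cross :: "int3 \<Rightarrow> int3 \<Rightarrow> int3" where
  "cross = (\<lambda>(x, y, z) (x', y', z').
     (y * z' - z * y', z * x' - x * z', x * y' - y * x'))"

definition det3 :: "int3 \<Rightarrow> int3 \<Rightarrow> int3 \<Rightarrow> int" where
  "det3 u v w = dot3 u (cross v w)"

text \<open>The direct rotation of angle t about the axis oriented by a unit vector u is
  v \<mapsto> cos t v + sin t (u \<times> v) + (1 - cos t) (u \<bullet> v) u.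
  The first definition below is the case t = \<pi>/2. The second is the case
  u = d / sqrt 3 and t = 2\<pi>/3, for d with all coordinates \<plusminus>1; for integral v the division
  by 2 in it is exact.\<close>

definition quarter_turn :: "int3 \<Rightarrow> int3 \<Rightarrow> int3" where
  "quarter_turn u v = cross u v + scale3 (dot3 u v) u"

definition third_turn :: "int3 \<Rightarrow> int3 \<Rightarrow> int3" where
  "third_turn d v = div3 (- v + cross d v + scale3 (dot3 d v) d) 2"


section \<open>Bundles of facets\<close>

text \<open>A facet is a pair whose first component is the piece carrying it. The field
  \<open>gen\<close> is the action on the facets of the class of 1 in \<open>C\<^sub>k\<close>, so that the class of \<open>m\<close>
  acts by \<open>gen ^^ m\<close>; it is only meaningful on the set of facets.\<close>

record ('p, 'l) facet_bundle =
  pieces :: "'p set"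
  facets :: "('p \<times> 'l) set"
  gen :: "'p \<times> 'l \<Rightarrow> 'p \<times> 'l"

text \<open>Maps are extensional, i.e. equal to \<open>undefined\<close> outside their domain, so that each map
  between sets is represented exactly once.\<close>

type_synonym ('p, 'l, 'q, 'm) bundle_map = "('p \<Rightarrow> 'q) \<times> ('p \<times> 'l \<Rightarrow> 'q \<times> 'm)"

definition bundle_iso ::
    "('p, 'l) facet_bundle \<Rightarrow> ('q, 'm) facet_bundle \<Rightarrow> ('p, 'l, 'q, 'm) bundle_map set" where
  "bundle_iso A B = {(f, F).
     f \<in> extensional (pieces A) \<and> bij_betw f (pieces A) (pieces B) \<and>
     F \<in> extensional (facets A) \<and> bij_betw F (facets A) (facets B) \<and>
     (\<forall>x\<in>facets A. fst (F x) = f (fst x)) \<and>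
     (\<forall>m. \<forall>x\<in>facets A. F ((gen A ^^ m) x) = (gen B ^^ m) (F x))}"

definition bundle_comp ::
    "('p, 'l) facet_bundle \<Rightarrow> ('q, 'm, 'r, 'n) bundle_map \<Rightarrow> ('p, 'l, 'q, 'm) bundle_map
      \<Rightarrow> ('p, 'l, 'r, 'n) bundle_map" where
  "bundle_comp A = (\<lambda>(g, G) (f, F). (compose (pieces A) g f, compose (facets A) G F))"

definition bundle_id :: "('p, 'l) facet_bundle \<Rightarrow> ('p, 'l, 'p, 'l) bundle_map" where
  "bundle_id A = ((\<lambda>a\<in>pieces A. a), (\<lambda>x\<in>facets A. x))"

definition bundle_inv ::
    "('p, 'l) facet_bundle \<Rightarrow> ('q, 'm) facet_bundle \<Rightarrow> ('p, 'l, 'q, 'm) bundle_map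
      \<Rightarrow> ('q, 'm, 'p, 'l) bundle_map" where
  "bundle_inv A B = (\<lambda>(f, F).
     (restrict (inv_into (pieces A) f) (pieces B), restrict (inv_into (facets A) F) (facets B)))"

definition bundle_aut :: "('p, 'l) facet_bundle \<Rightarrow> ('p, 'l, 'p, 'l) bundle_map monoid" where
  "bundle_aut A = \<lparr>carrier = bundle_iso A A, monoid.mult = bundle_comp A, one = bundle_id A\<rparr>"

text \<open>Only meaningful when every piece carries exactly two of the facets in X.\<close>

definition exchange :: "('p \<times> 'l) set \<Rightarrow> 'p \<times> 'l \<Rightarrow> 'p \<times> 'l" where
  "exchange X x = (THE y. y \<in> X \<and> fst y = fst x \<and> y \<noteq> x)"


section \<open>Geometric pieces\<close>

definition cubies :: "nat \<Rightarrow> int3 set" where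
  "cubies m = {c. (\<forall>i\<in>{1, 2, 3}. coord i c \<in> {-3, -1, 1, 3}) \<and>
                  card {i \<in> {1, 2, 3}. coord i c \<in> {-3, 3}} = m}"

definition normals :: "int3 set" where
  "normals = axis_vec ` {1, 2, 3} \<union> (\<lambda>i. - axis_vec i) ` {1, 2, 3}"

definition geom_facets :: "int3 set \<Rightarrow> (int3 \<times> int3) set" where
  "geom_facets S = {(c, n). c \<in> S \<and> n \<in> normals \<and> dot3 c n = 3}"

definition ArGeom :: "(int3, int3) facet_bundle" where
  "ArGeom = \<lparr>pieces = cubies 2, facets = geom_facets (cubies 2),
             gen = exchange (geom_facets (cubies 2))\<rparr>"

definition SomGeom :: "(int3, int3) facet_bundle" where
  "SomGeom = \<lparr>pieces = cubies 3, facets = geom_facets (cubies 3),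
              gen = (\<lambda>(c, n). (c, third_turn (- div3 c 3) n))\<rparr>"

definition CentGeom :: "int3 set" where
  "CentGeom = cubies 1"


section \<open>Material pieces\<close>

datatype colour = Blanc | Jaune | Bleu | Vert | Orange | Rouge

definition opposite :: "colour \<Rightarrow> colour \<Rightarrow> bool" where
  "opposite a b \<longleftrightarrow> {a, b} \<in> {{Blanc, Jaune}, {Bleu, Vert}, {Orange, Rouge}}"

type_synonym edge_mat = "colour set \<times> nat"

definition ar_pieces :: "edge_mat set" where
  "ar_pieces = {{a, b} |a b. a \<noteq> b \<and> \<not> opposite a b} \<times> {1, 2}"

definition ar_facets :: "(edge_mat \<times> colour) set" where
  "ar_facets = {((P, j), c). (P, j) \<in> ar_pieces \<and> c \<in> P}"

definition ArMat :: "(edge_mat, colour) facet_bundle" where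
  "ArMat = \<lparr>pieces = ar_pieces, facets = ar_facets, gen = exchange ar_facets\<rparr>"

definition corner_cycles :: "colour list list" where
  "corner_cycles =
     [[Blanc, Bleu, Rouge], [Blanc, Orange, Bleu], [Blanc, Vert, Orange], [Blanc, Rouge, Vert],
      [Jaune, Rouge, Bleu], [Jaune, Bleu, Orange], [Jaune, Vert, Rouge], [Jaune, Orange, Vert]]"

definition SomMat :: "(colour set, colour) facet_bundle" where
  "SomMat =
     (let T = {{a, b, d} |a b d. a \<noteq> b \<and> b \<noteq> d \<and> a \<noteq> d \<and>
                 \<not> opposite a b \<and> \<not> opposite b d \<and> \<not> opposite a d}
      in \<lparr>pieces = T, facets = {(t, c). t \<in> T \<and> c \<in> t},
          gen = (\<lambda>(t, c). (t, cycle_of_list (the (find (\<lambda>l. set l = t) corner_cycles)) c))\<rparr>)"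

definition CentMat :: "(colour \<times> nat) set" where
  "CentMat = UNIV \<times> {1..4}"


section \<open>Marked colourings and the groups acting on them\<close>

type_synonym rev =
  "(int3, int3, edge_mat, colour) bundle_map \<times> (int3, int3, colour set, colour) bundle_map \<times>
   (int3 \<Rightarrow> colour \<times> nat)"

type_synonym rev_inv =
  "(edge_mat, colour, int3, int3) bundle_map \<times> (colour set, colour, int3, int3) bundle_map \<times>
   (colour \<times> nat \<Rightarrow> int3)"

type_synonym tgeom =
  "(int3, int3, int3, int3) bundle_map \<times> (int3, int3, int3, int3) bundle_map \<times> (int3 \<Rightarrow> int3)"

type_synonym tmat =
  "(edge_mat, colour, edge_mat, colour) bundle_map \<times>
   (colour set, colour, colour set, colour) bundle_map \<times> (colour \<times> nat \<Rightarrow> colour \<times> nat)"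

definition Rev_marq :: "rev set" where
  "Rev_marq = bundle_iso ArGeom ArMat \<times> bundle_iso SomGeom SomMat \<times>
     {h \<in> extensional CentGeom. bij_betw h CentGeom CentMat}"

definition T_geom :: "tgeom monoid" where
  "T_geom = bundle_aut ArGeom \<times>\<times> bundle_aut SomGeom \<times>\<times> BijGroup CentGeom"

definition T_mat :: "tmat monoid" where
  "T_mat = bundle_aut ArMat \<times>\<times> bundle_aut SomMat \<times>\<times> BijGroup CentMat"

definition act_right :: "rev \<Rightarrow> tgeom \<Rightarrow> rev" where
  "act_right = (\<lambda>(f, g, h) (a, b, p).
     (bundle_comp ArGeom f a, bundle_comp SomGeom g b, compose CentGeom h p))"

definition act_left :: "tmat \<Rightarrow> rev \<Rightarrow> rev" where
  "act_left = (\<lambda>(a, b, p) (f, g, h).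
     (bundle_comp ArGeom a f, bundle_comp SomGeom b g, compose CentGeom p h))"

definition rev_inverse :: "rev \<Rightarrow> rev_inv" where
  "rev_inverse = (\<lambda>(f, g, h). (bundle_inv ArGeom ArMat f, bundle_inv SomGeom SomMat g,
     restrict (inv_into CentGeom h) CentMat))"

definition comp_inv :: "rev \<Rightarrow> rev_inv \<Rightarrow> tmat" where
  "comp_inv = (\<lambda>(f, g, h) (f', g', h').
     (bundle_comp ArMat f f', bundle_comp SomMat g g', compose CentMat h h'))"


section \<open>Legal moves\<close>

definition slice_cubie :: "nat \<Rightarrow> int \<Rightarrow> int3 \<Rightarrow> int3" where
  "slice_cubie i v c = (if coord i c = v then quarter_turn (axis_vec i) c else c)"

definition slice_facet :: "nat \<Rightarrow> int \<Rightarrow> int3 \<times> int3 \<Rightarrow> int3 \<times> int3" where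
  "slice_facet i v = (\<lambda>(c, n).
     if coord i c = v then (quarter_turn (axis_vec i) c, quarter_turn (axis_vec i) n) else (c, n))"

definition slice_move :: "nat \<Rightarrow> int \<Rightarrow> tgeom" where
  "slice_move i v =
     ((restrict (slice_cubie i v) (pieces ArGeom), restrict (slice_facet i v) (facets ArGeom)),
      (restrict (slice_cubie i v) (pieces SomGeom), restrict (slice_facet i v) (facets SomGeom)),
      restrict (slice_cubie i v) CentGeom)"

definition Legal :: "tgeom set" where
  "Legal = generate T_geom {slice_move i v |i v. i \<in> {1, 2, 3} \<and> v \<in> {-3, -1, 1, 3}}"


section \<open>Indistinguishable transformations\<close>

definition I_Ar :: "(edge_mat, colour, edge_mat, colour) bundle_map set" where
  "I_Ar = {(f, F) \<in> carrier (bundle_aut ArMat).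
     \<forall>P j c. ((P, j), c) \<in> facets ArMat \<longrightarrow> (\<exists>j'. F ((P, j), c) = ((P, j'), c))}"

definition I_Cent :: "(colour \<times> nat \<Rightarrow> colour \<times> nat) set" where
  "I_Cent = {p \<in> carrier (BijGroup CentMat). \<forall>x\<in>CentMat. fst (p x) = fst x}"

definition Indist :: "tmat set" where
  "Indist = I_Ar \<times> {\<one>\<^bsub>bundle_aut SomMat\<^esub>} \<times> I_Cent"


section \<open>Solved state\<close>

definition col :: "int3 \<Rightarrow> colour" where
  "col n =
     (if n = axis_vec 1 then Rouge else if n = - axis_vec 1 then Orange
      else if n = axis_vec 2 then Bleu else if n = - axis_vec 2 then Vert
      else if n = axis_vec 3 then Blanc else Jaune)"

definition is_solved_state :: "rev \<Rightarrow> bool" where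
  "is_solved_state = (\<lambda>((f, F), (g, G), h).
     ((f, F), (g, G), h) \<in> Rev_marq \<and>
     (\<forall>(c, n)\<in>facets ArGeom. snd (F (c, n)) = col n) \<and>
     (\<forall>(c, n)\<in>facets SomGeom. snd (G (c, n)) = col n) \<and>
     (\<forall>(c, n)\<in>geom_facets CentGeom. fst (h c) = col n))"


section \<open>Mechanical constraints\<close>

definition edge_section :: "int3 \<Rightarrow> int3 \<times> int3" where
  "edge_section c = (THE x. \<exists>n n' k. x = (c, n) \<and> (c, n) \<in> facets ArGeom \<and>
     (c, n') \<in> facets ArGeom \<and> n \<noteq> n' \<and> k \<in> {1, 2, 3} \<and> coord k c \<in> {-1, 1} \<and>
     det3 n n' (scale3 (coord k c) (axis_vec k)) > 0)"

definition T'_geom :: "tgeom set" where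
  "T'_geom = {((\<sigma>, \<Phi>), (\<tau>, \<Psi>), \<phi>) \<in> carrier T_geom.
     \<forall>\<alpha>\<in>pieces ArGeom. \<Phi> (edge_section \<alpha>) = edge_section (\<sigma> \<alpha>)}"

definition Rev_meca :: "rev \<Rightarrow> rev set" where
  "Rev_meca x0 = {act_right x0 t |t. t \<in> T'_geom}"

definition I' :: "rev \<Rightarrow> tmat set" where
  "I' x0 = Indist \<inter> {comp_inv (act_right x0 t) (rev_inverse x0) |t. t \<in> T'_geom}"

definition solvable_meca :: "rev \<Rightarrow> rev set" where
  "solvable_meca x0 = {act_right (act_left t x0) l |t l. t \<in> I' x0 \<and> l \<in> Legal}"

end

theory Submission
  imports Defs
begin

text \<open>
  Forgetting the redundant facet maps, an element of \<open>T'_geom\<close> consists of a permutation of the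
  24 edges, a \<open>C\<^sub>3\<close>-equivariant permutation of the 24 corner facets, and a permutation of the 24
  centres. Its \<open>twist\<close>, the sum in \<open>\<int>/3\<close> of the rotations of the corners relative to chosen
  base facets, is a homomorphism onto \<open>\<int>/3\<close>. It vanishes on each elementary move, and an
  indistinguishable transformation does not touch the corners. Hence the solvable colourings lie
  in \<open>{x\<^sub>0 t | twist t = 0}\<close>. The theorem says that they fill this set (\<open>solvable_meca_eq\<close>);
  the factor 3 is then the number of values of the twist (\<open>card_T'_geom\<close>), as
  \<open>t \<mapsto> x\<^sub>0 t\<close> is injective.

  The legal moves satisfy one more constraint: the permutations of corners and of centres have the
  same sign. It is absorbed by the transposition of two centres of the same colour, which
  belongs to \<open>x\<^sub>0\<^sup>-\<^sup>1 \<I>' x\<^sub>0\<close>. This permits a triangular argument, without any computation of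
  signs (\<open>all_realised\<close>). Modulo edges and centres, the moves realise all equivariant maps of
  corner facets of twist zero, as for the \<open>2\<times>2\<times>2\<close> cube: an explicit word exchanges two corners
  and another one turns two corners in opposite directions (\<open>corners_realised\<close>). Modulo centres,
  there is a word exchanging two edges and fixing the corners, hence all permutations of
  edges can be adjusted (\<open>edges_realised\<close>). Finally a commutator gives a 3-cycle of centres moving
  nothing else, so that the centres can be adjusted up to the transposition above
  (\<open>centres_realised\<close>). In each case the explicit word is conjugated by moves that stabilise some
  of the pieces and are transitive on the others.

  The remaining part identifies the subgroup of legal moves with the set of words in the elementary
  moves (\<open>Legal_realise\<close>, \<open>realise_Legal\<close>), using that each of them has order 4, and
  translates products with elements of \<open>\<I>'\<close> into the right action of \<open>T'_geom\<close>.
\<close>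

section \<open>Words in the elementary moves\<close>

type_synonym move = "nat \<times> int"

definition moves :: "move set" where
  "moves = {1, 2, 3} \<times> {-3, -1, 1, 3}"

abbreviation legal_word :: "move list \<Rightarrow> bool" where
  "legal_word w \<equiv> set w \<subseteq> moves"

abbreviation turn_cubie :: "move list \<Rightarrow> int3 \<Rightarrow> int3" where
  "turn_cubie \<equiv> foldr (case_prod slice_cubie)"

abbreviation turn_facet :: "move list \<Rightarrow> int3 \<times> int3 \<Rightarrow> int3 \<times> int3" where
  "turn_facet \<equiv> foldr (case_prod slice_facet)"

text \<open>Every elementary move has order 4, so its inverse is its cube. Hence the words, in which only
  direct quarter turns occur, already exhaust the group generated by the moves. The rightmost move
  of a word is performed first, as in a product of permutations.\<close>

definition undo :: "move list \<Rightarrow> move list" where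
  "undo w = concat (map (replicate 3) (rev w))"

lemma undo_Cons: "undo (m # w) = undo w @ [m, m, m]"
  by (simp add: undo_def eval_nat_numeral)

lemma legal_undo: "legal_word w \<Longrightarrow> legal_word (undo w)"
  by (auto simp: undo_def)

lemma slice_facet_4:
  assumes "m \<in> moves"
  shows "turn_facet [m, m, m, m] x = x"
proof -
  obtain i v c1 c2 c3 n1 n2 n3 where "m = (i, v)" "x = ((c1, c2, c3), (n1, n2, n3))"
    by (metis prod.exhaust)
  moreover from this assms have "i = 1 \<or> i = 2 \<or> i = 3"
    by (auto simp: moves_def)
  ultimately show ?thesis
    by (elim disjE) (simp_all add: slice_facet_def coord_def quarter_turn_def axis_vec_def
        cross_def scale3_def dot3_def)
qed

lemma fst_turn_facet: "fst (turn_facet w x) = turn_cubie w (fst x)"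
  by (induction w) (auto simp: slice_facet_def slice_cubie_def split: prod.splits)

lemma turn_facet_undo:
  assumes "legal_word w"
  shows "turn_facet (undo w) (turn_facet w x) = x" "turn_facet w (turn_facet (undo w) x) = x"
proof -
  show "turn_facet (undo w) (turn_facet w x) = x"
    using assms
  proof (induction w)
    case (Cons m w)
    then show ?case
      using slice_facet_4[of m "turn_facet w x"] by (simp add: undo_Cons)
  qed (simp add: undo_def)
  show "turn_facet w (turn_facet (undo w) x) = x"
    using assms
  proof (induction w arbitrary: x)
    case (Cons m w)
    then show ?case
      using slice_facet_4[of m x] by (simp add: undo_Cons)
  qed (simp add: undo_def)
qed

lemma turn_cubie_undo:
  assumes "legal_word w"
  shows "turn_cubie (undo w) (turn_cubie w c) = c" "turn_cubie w (turn_cubie (undo w) c) = c"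
  using turn_facet_undo[OF assms, of "(c, 0)"] by (metis fst_conv fst_turn_facet)+

lemma inj_turn_cubie: "legal_word w \<Longrightarrow> inj (turn_cubie w)"
  by (metis injI turn_cubie_undo(1))


section \<open>Finite enumerations\<close>

abbreviation edges :: "int3 set" where "edges \<equiv> cubies 2"
abbreviation corners :: "int3 set" where "corners \<equiv> cubies 3"
abbreviation centres :: "int3 set" where "centres \<equiv> cubies 1"
abbreviation edge_facets :: "(int3 \<times> int3) set" where "edge_facets \<equiv> geom_facets edges"
abbreviation corner_facets :: "(int3 \<times> int3) set" where "corner_facets \<equiv> geom_facets corners"

text \<open>The finitely many facts about single moves, single pieces and the explicit words below are
  checked by evaluation over these lists.\<close>

definition cubie_list :: "nat \<Rightarrow> int3 list" where
  "cubie_list m =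
     filter (\<lambda>(x, y, z). of_bool (\<bar>x\<bar> = 3) + of_bool (\<bar>y\<bar> = 3) + of_bool (\<bar>z\<bar> = 3) = m)
       (List.product [-3, -1, 1, 3] (List.product [-3, -1, 1, 3] [-3, -1, 1, 3]))"

lemma cubies_list: "cubies m = set (cubie_list m)"
proof -
  have *: "card {i \<in> {1, 2, 3::nat}. P i} = of_bool (P 1) + of_bool (P 2) + of_bool (P 3)" for P
  proof -
    have "{i \<in> {1, 2, 3::nat}. P i} =
        (if P 1 then {1} else {}) \<union> (if P 2 then {2} else {}) \<union> (if P 3 then {3} else {})"
      by auto
    then show ?thesis by simp
  qed
  have "c \<in> cubies m \<longleftrightarrow> c \<in> set (cubie_list m)" for c
  proof -
    obtain x y z where c: "c = (x, y, z)" by (metis prod.exhaust)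
    let ?L = "[-3, -1, 1, 3] :: int list"
    have "c \<in> set (List.product L (List.product L L)) \<longleftrightarrow> (\<forall>i\<in>{1, 2, 3}. coord i c \<in> set L)" for L
      by (auto simp: c coord_def)
    from this[of ?L] have "c \<in> set (List.product ?L (List.product ?L ?L)) \<longleftrightarrow>
        (\<forall>i\<in>{1, 2, 3}. coord i c \<in> {-3, -1, 1, 3})"
      by (simp only: list.set)
    moreover have "coord i c \<in> {-3, 3} \<longleftrightarrow> \<bar>coord i c\<bar> = 3" for i
      by auto
    ultimately show ?thesis
      unfolding cubies_def mem_Collect_eq * cubie_list_def set_filter
      by (simp only:) (simp add: c coord_def conj_commute)
  qed
  then show ?thesis by blast
qed

definition facet_list :: "nat \<Rightarrow> (int3 \<times> int3) list" where
  "facet_list m = filter (\<lambda>(c, n). dot3 c n = 3)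
     (List.product (cubie_list m)
       [(1, 0, 0), (0, 1, 0), (0, 0, 1), (-1, 0, 0), (0, -1, 0), (0, 0, -1)])"

lemma normals_list:
  "normals = set [(1, 0, 0), (0, 1, 0), (0, 0, 1), (-1, 0, 0), (0, -1, 0), (0, 0, -1)]"
  by (auto simp: normals_def axis_vec_def)

lemma geom_facets_list: "geom_facets (cubies m) = set (facet_list m)"
  unfolding geom_facets_def cubies_list normals_list facet_list_def by auto

lemma moves_list: "moves = set (List.product [1, 2, 3] [-3, -1, 1, 3])"
  by (simp add: moves_def)

lemmas enumerations = moves_list cubies_list geom_facets_list[unfolded cubies_list] normals_list

lemma finite_cubies [simp]: "finite (cubies m)"
  by (simp add: cubies_list)

lemma finite_geom_facets [simp]: "finite (geom_facets (cubies m))"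
  by (simp add: geom_facets_list)

lemma fst_geom_facets: "x \<in> geom_facets S \<Longrightarrow> fst x \<in> S"
  by (auto simp: geom_facets_def)

lemma cubies_iff:
  "(x, y, z) \<in> cubies m \<longleftrightarrow>
     \<bar>x\<bar> \<in> {1, 3} \<and> \<bar>y\<bar> \<in> {1, 3} \<and> \<bar>z\<bar> \<in> {1, 3} \<and>
     of_bool (\<bar>x\<bar> = 3) + of_bool (\<bar>y\<bar> = 3) + of_bool (\<bar>z\<bar> = 3) = m"
proof -
  have "t \<in> set [-3, -1, 1, 3] \<longleftrightarrow> \<bar>t\<bar> \<in> {1, 3}" for t :: int by auto
  moreover have "(x, y, z) \<in> set (List.product L (List.product L L)) \<longleftrightarrow> x \<in> set L \<and> y \<in> set L \<and> z \<in> set L"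
    for L by auto
  ultimately show ?thesis
    unfolding cubies_list cubie_list_def set_filter mem_Collect_eq prod.case by blast
qed

lemma quarter_turn_axis:
  "quarter_turn (axis_vec 1) (x, y, z) = (x, - z, y)"
  "quarter_turn (axis_vec 2) (x, y, z) = (z, y, - x)"
  "quarter_turn (axis_vec 3) (x, y, z) = (- y, x, z)"
  by (simp_all add: quarter_turn_def axis_vec_def cross_def scale3_def dot3_def)

lemma quarter_turn_closed:
  assumes "i \<in> {1, 2, 3}"
  shows "quarter_turn (axis_vec i) c \<in> cubies k \<longleftrightarrow> c \<in> cubies k"
    and "quarter_turn (axis_vec i) c \<in> normals \<longleftrightarrow> c \<in> normals"
    and "dot3 (quarter_turn (axis_vec i) c) (quarter_turn (axis_vec i) n) = dot3 c n"
proof -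
  obtain x y z x' y' z' where c: "c = (x, y, z)" and n: "n = (x', y', z')" by (metis prod.exhaust)
  have cubies: "(x, - z, y) \<in> cubies k \<longleftrightarrow> (x, y, z) \<in> cubies k"
    "(z, y, - x) \<in> cubies k \<longleftrightarrow> (x, y, z) \<in> cubies k"
    "(- y, x, z) \<in> cubies k \<longleftrightarrow> (x, y, z) \<in> cubies k"
    by (simp_all only: cubies_iff abs_minus_cancel conj_ac add_ac)
  have normals: "(x, - z, y) \<in> normals \<longleftrightarrow> (x, y, z) \<in> normals"
    "(z, y, - x) \<in> normals \<longleftrightarrow> (x, y, z) \<in> normals"
    "(- y, x, z) \<in> normals \<longleftrightarrow> (x, y, z) \<in> normals"
    unfolding normals_list by auto
  have dot: "dot3 (x, - z, y) (x', - z', y') = dot3 (x, y, z) (x', y', z')"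
    "dot3 (z, y, - x) (z', y', - x') = dot3 (x, y, z) (x', y', z')"
    "dot3 (- y, x, z) (- y', x', z') = dot3 (x, y, z) (x', y', z')"
    by (simp_all add: dot3_def)
  consider "i = 1" | "i = 2" | "i = 3" using assms by blast
  note cases = this
  show "quarter_turn (axis_vec i) c \<in> cubies k \<longleftrightarrow> c \<in> cubies k"
    by (rule cases) (simp_all only: c quarter_turn_axis cubies)
  show "quarter_turn (axis_vec i) c \<in> normals \<longleftrightarrow> c \<in> normals"
    by (rule cases) (simp_all only: c quarter_turn_axis normals)
  show "dot3 (quarter_turn (axis_vec i) c) (quarter_turn (axis_vec i) n) = dot3 c n"
    by (rule cases) (simp_all only: c n quarter_turn_axis dot)
qed

lemma turn_cubie_closed:
  assumes "legal_word w" "c \<in> cubies k"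
  shows "turn_cubie w c \<in> cubies k"
  using assms
proof (induction w)
  case (Cons m w)
  then obtain i v where "m = (i, v)" "i \<in> {1, 2, 3}" by (auto simp: moves_def)
  with Cons show ?case by (simp add: slice_cubie_def quarter_turn_closed)
qed simp

lemma turn_facet_closed:
  assumes "legal_word w" "x \<in> geom_facets (cubies k)"
  shows "turn_facet w x \<in> geom_facets (cubies k)"
  using assms
proof (induction w)
  case (Cons m w)
  then obtain i v where m: "m = (i, v)" "i \<in> {1, 2, 3}" by (auto simp: moves_def)
  obtain c n where cn: "turn_facet w x = (c, n)" by (metis prod.exhaust)
  with Cons have "(c, n) \<in> geom_facets (cubies k)" by simp
  then have "slice_facet i v (c, n) \<in> geom_facets (cubies k)"
    using m(2) by (simp add: slice_facet_def quarter_turn_closed geom_facets_def)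
  then show ?case
    using m cn by simp
qed simp

lemma bij_turn_cubie:
  assumes "legal_word w"
  shows "bij_betw (turn_cubie w) (cubies k) (cubies k)"
  by (rule bij_betw_byWitness[where f' = "turn_cubie (undo w)"])
    (use assms turn_cubie_undo turn_cubie_closed legal_undo in auto)

lemma bij_turn_facet:
  assumes "legal_word w"
  shows "bij_betw (turn_facet w) (geom_facets (cubies k)) (geom_facets (cubies k))"
  by (rule bij_betw_byWitness[where f' = "turn_facet (undo w)"])
    (use assms turn_facet_undo turn_facet_closed legal_undo in auto)


section \<open>Edges: the exchange of facets and the section\<close>

text \<open>For an edge \<open>c\<close> with facets \<open>(c, n)\<close> and \<open>(c, n')\<close> this is \<open>n + n'\<close>, and
  \<open>c - 3 (n + n')\<close> is the vector \<open>c\<^sub>k e\<^sub>k\<close> that enters the definition of the section.\<close>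

definition outer_part :: "int3 \<Rightarrow> int3" where
  "outer_part = (\<lambda>(x, y, z). let t = (\<lambda>a. if \<bar>a\<bar> = 3 then sgn a else 0) in (t x, t y, t z))"

text \<open>The exchange of the two facets of an edge as a globally defined affine formula. In this form its
  commutation with rotations is visible.\<close>

definition flip :: "int3 \<times> int3 \<Rightarrow> int3 \<times> int3" where
  "flip = (\<lambda>(c, n). (c, outer_part c - n))"

text \<open>The section \<open>s\<close> in a form that can be evaluated. An automorphism in \<open>T'_geom\<close> is
  determined on edge facets by its effect on edges, because each edge facet is \<open>edge_base c\<close> or
  its flip.\<close>

definition edge_base :: "int3 \<Rightarrow> int3 \<times> int3" where
  "edge_base c = (c, the (find
     (\<lambda>n. dot3 c n = 3 \<and> det3 n (outer_part c - n) (c - scale3 3 (outer_part c)) > 0)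
     [(1, 0, 0), (0, 1, 0), (0, 0, 1), (-1, 0, 0), (0, -1, 0), (0, 0, -1)]))"

lemma edge_facets_two:
  assumes "(c, n) \<in> edge_facets" "(c, n') \<in> edge_facets" "n \<noteq> n'"
  shows "n' = outer_part c - n"
proof -
  have "\<forall>x\<in>edge_facets. \<forall>n'\<in>normals. dot3 (fst x) n' = 3 \<longrightarrow> n' = snd x \<or> n' = outer_part (fst x) - snd x"
    unfolding enumerations by code_simp
  then show ?thesis
    using assms by (fastforce simp: geom_facets_def)
qed

lemma flip_closed:
  assumes "x \<in> edge_facets"
  shows "flip x \<in> edge_facets" "flip x \<noteq> x"
proof -
  have "\<forall>x\<in>edge_facets. snd (flip x) \<in> normals \<and> dot3 (fst x) (snd (flip x)) = 3 \<and> flip x \<noteq> x"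
    unfolding enumerations by code_simp
  then show "flip x \<in> edge_facets" "flip x \<noteq> x"
    using assms by (fastforce simp: geom_facets_def flip_def)+
qed

lemma exchange_edge:
  assumes "x \<in> edge_facets"
  shows "exchange edge_facets x = flip x"
  unfolding exchange_def
proof (rule the_equality)
  show "flip x \<in> edge_facets \<and> fst (flip x) = fst x \<and> flip x \<noteq> x"
    using flip_closed[OF assms] by (simp add: flip_def split: prod.split)
next
  fix y assume "y \<in> edge_facets \<and> fst y = fst x \<and> y \<noteq> x"
  then show "y = flip x"
    using edge_facets_two[of "fst x" "snd x" "snd y"] assms
    by (metis (no_types, lifting) case_prod_beta flip_def prod.collapse)
qed

lemma edge_base_closed: "c \<in> edges \<Longrightarrow> edge_base c \<in> edge_facets"
proof -
  have "\<forall>c\<in>edges. snd (edge_base c) \<in> normals \<and> dot3 c (snd (edge_base c)) = 3"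
    unfolding enumerations by code_simp
  then show "c \<in> edges \<Longrightarrow> edge_base c \<in> edge_facets"
    by (simp add: geom_facets_def edge_base_def)
qed

lemma edge_facet_cases:
  assumes "x \<in> edge_facets"
  shows "x = edge_base (fst x) \<or> x = flip (edge_base (fst x))"
proof -
  have "\<forall>x\<in>edge_facets. x = edge_base (fst x) \<or> x = flip (edge_base (fst x))"
    unfolding enumerations by code_simp
  then show ?thesis using assms by blast
qed

lemma ArGeom_simps [simp]:
  "pieces ArGeom = edges" "facets ArGeom = edge_facets"
  "gen ArGeom = exchange edge_facets"
  by (simp_all add: ArGeom_def)

lemma edge_section_eq:
  assumes "c \<in> edges"
  shows "edge_section c = edge_base c"
proof -
  let ?pos = "\<lambda>c n. det3 n (outer_part c - n) (c - scale3 3 (outer_part c)) > 0"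
  have base: "\<forall>x\<in>edge_facets. ?pos (fst x) (snd x) \<longleftrightarrow> x = edge_base (fst x)"
    unfolding enumerations by code_simp
  have axis: "\<forall>c\<in>edges. \<forall>k\<in>{1, 2, 3}. coord k c \<in> {-1, 1} \<longrightarrow>
      scale3 (coord k c) (axis_vec k) = c - scale3 3 (outer_part c)"
    unfolding enumerations by code_simp
  have ex: "\<forall>c\<in>edges. \<exists>k\<in>{1, 2, 3}. coord k c \<in> {-1, 1}"
    unfolding enumerations by code_simp
  let ?P = "\<lambda>x n n' k. x = (c, n) \<and> (c, n) \<in> facets ArGeom \<and> (c, n') \<in> facets ArGeom \<and>
    n \<noteq> n' \<and> k \<in> {1, 2, 3} \<and> coord k c \<in> {-1, 1} \<and> det3 n n' (scale3 (coord k c) (axis_vec k)) > 0"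
  show ?thesis
    unfolding edge_section_def
  proof (rule the_equality)
    obtain n where n: "edge_base c = (c, n)" by (simp add: edge_base_def)
    obtain k where k: "k \<in> {1, 2, 3}" "coord k c \<in> {-1, 1}" using ex assms by blast
    have c: "(c, n) \<in> edge_facets" using edge_base_closed[OF assms] n by simp
    then have "(c, outer_part c - n) \<in> edge_facets" "outer_part c - n \<noteq> n" "?pos c n"
      using flip_closed[OF c] base n by (auto simp: flip_def)
    moreover have "scale3 (coord k c) (axis_vec k) = c - scale3 3 (outer_part c)"
      using axis assms k by blast
    ultimately have "?P (edge_base c) n (outer_part c - n) k"
      using n c k by auto
    then show "\<exists>n n' k. ?P (edge_base c) n n' k" by blast
  next
    fix x assume "\<exists>n n' k. ?P x n n' k"
    then obtain n n' k where P: "?P x n n' k" by blast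
    then have "n' = outer_part c - n" using edge_facets_two by simp
    moreover have "scale3 (coord k c) (axis_vec k) = c - scale3 3 (outer_part c)"
      using P axis assms by blast
    ultimately show "x = edge_base c"
      using P base by fastforce
  qed
qed

lemma turn_facet_flip:
  assumes "legal_word w"
  shows "turn_facet w (flip x) = flip (turn_facet w x)"
proof -
  have *: "slice_facet i v (flip x) = flip (slice_facet i v x)" if "(i, v) \<in> moves" for i v x
  proof -
    obtain c1 c2 c3 n1 n2 n3 where "x = ((c1, c2, c3), (n1, n2, n3))"
      by (metis prod.exhaust)
    moreover from that have "i = 1 \<or> i = 2 \<or> i = 3"
      by (auto simp: moves_def)
    ultimately show ?thesis
      by (elim disjE) (simp_all add: slice_facet_def quarter_turn_axis flip_def outer_part_def Let_def
          quarter_turn_axis(1)[unfolded One_nat_def])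
  qed
  show ?thesis
    using assms by (induction w) (auto simp: *)
qed

text \<open>Rotations preserve determinants, so no move can flip an edge without displacing it: this is the
  mechanical constraint.\<close>

lemma turn_facet_edge_base:
  assumes "legal_word w" "c \<in> edges"
  shows "turn_facet w (edge_base c) = edge_base (turn_cubie w c)"
proof -
  have *: "\<forall>m\<in>moves. \<forall>c\<in>edges. case_prod slice_facet m (edge_base c) = edge_base (case_prod slice_cubie m c)"
    unfolding enumerations by code_simp
  show ?thesis
    using assms(1)
  proof (induction w)
    case (Cons m w)
    then show ?case
      using * turn_cubie_closed[of w c 2] assms(2) by simp
  qed simp
qed


section \<open>Corners: rotation, heights and the twist\<close>

definition rot :: "int3 \<times> int3 \<Rightarrow> int3 \<times> int3" where
  "rot = (\<lambda>(c, n). (c, third_turn (- div3 c 3) n))"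

text \<open>Any choice of one facet for each corner would do; the one orthogonal to the third axis is
  convenient. Counting direct rotations from it identifies the facets of each corner with
  \<open>\<int>/3\<close>, which is the height.\<close>

definition corner_base :: "int3 \<Rightarrow> int3 \<times> int3" where
  "corner_base c = (c, (0, 0, coord 3 c div 3))"

definition height :: "int3 \<times> int3 \<Rightarrow> int" where
  "height x = (if x = corner_base (fst x) then 0 else if x = rot (corner_base (fst x)) then 1 else 2)"

lemma SomGeom_simps [simp]:
  "pieces SomGeom = corners" "facets SomGeom = corner_facets" "gen SomGeom = rot"
  by (simp_all add: SomGeom_def rot_def)

lemma fst_rot [simp]: "fst (rot x) = fst x"
  by (simp add: rot_def split: prod.split)

lemma fst_corner_base [simp]: "fst (corner_base c) = c"
  by (simp add: corner_base_def)

lemma height_corner_base [simp]: "height (corner_base c) = 0"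
  by (simp add: height_def)

lemma height_range: "height x \<in> {0..2}"
  by (simp add: height_def)

lemma corner_base_closed: "c \<in> corners \<Longrightarrow> corner_base c \<in> corner_facets"
proof -
  have "\<forall>c\<in>corners. snd (corner_base c) \<in> normals \<and> dot3 c (snd (corner_base c)) = 3"
    unfolding enumerations by code_simp
  then show "c \<in> corners \<Longrightarrow> corner_base c \<in> corner_facets"
    by (simp add: geom_facets_def corner_base_def)
qed

lemma
  assumes "x \<in> corner_facets"
  shows rot_closed: "rot x \<in> corner_facets"
    and rot_3: "rot (rot (rot x)) = x"
    and height_rot: "height (rot x) = (height x + 1) mod 3"
    and corner_facet_cases: "x = corner_base (fst x) \<or> x = rot (corner_base (fst x)) \<or>
      x = rot (rot (corner_base (fst x)))"
proof -
  have *: "\<forall>x\<in>corner_facets. snd (rot x) \<in> normals \<and> dot3 (fst x) (snd (rot x)) = 3 \<and> rot (rot (rot x)) = x \<and>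
      height (rot x) = (height x + 1) mod 3 \<and> (x = corner_base (fst x) \<or>
      x = rot (corner_base (fst x)) \<or> x = rot (rot (corner_base (fst x))))"
    unfolding enumerations by code_simp
  then show "rot (rot (rot x)) = x" "height (rot x) = (height x + 1) mod 3"
    "x = corner_base (fst x) \<or> x = rot (corner_base (fst x)) \<or> x = rot (rot (corner_base (fst x)))"
    using assms by blast+
  show "rot x \<in> corner_facets"
    using * assms by (fastforce simp: geom_facets_def rot_def)
qed

lemma corner_facet_eqI:
  assumes "x \<in> corner_facets" "y \<in> corner_facets" "fst x = fst y" "height x = height y"
  shows "x = y"
proof -
  let ?b = "corner_base (fst x)"
  have b: "?b \<in> corner_facets" "rot ?b \<in> corner_facets"
    using assms(1) by (auto intro: corner_base_closed rot_closed fst_geom_facets)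
  have "height ?b = 0" "height (rot ?b) = 1" "height (rot (rot ?b)) = 2"
    using height_rot[OF b(1)] height_rot[OF b(2)] by auto
  with corner_facet_cases[OF assms(1)] corner_facet_cases[OF assms(2)] assms(3,4)
  show ?thesis by (metis (no_types) zero_neq_numeral zero_neq_one numeral_eq_one_iff semiring_norm(85))
qed

definition equivariant :: "(int3 \<times> int3 \<Rightarrow> int3 \<times> int3) \<Rightarrow> bool" where
  "equivariant \<Psi> \<longleftrightarrow> (\<forall>x\<in>corner_facets. \<Psi> x \<in> corner_facets \<and> \<Psi> (rot x) = rot (\<Psi> x))"

text \<open>The total rotation of the corners. Since \<open>\<int>/3\<close> is abelian, the order in which the corners
  are permuted does not matter, so the twist is a homomorphism.\<close>

definition twist :: "(int3 \<times> int3 \<Rightarrow> int3 \<times> int3) \<Rightarrow> int" where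
  "twist \<Psi> = (\<Sum>c\<in>corners. height (\<Psi> (corner_base c))) mod 3"

text \<open>An equivariant map is, over each corner, a translation of \<open>\<int>/3\<close>.\<close>

lemma equivariant_height:
  assumes "equivariant \<Psi>" "x \<in> corner_facets"
  shows "fst (\<Psi> x) = fst (\<Psi> (corner_base (fst x)))"
    and "height (\<Psi> x) = (height x + height (\<Psi> (corner_base (fst x)))) mod 3"
proof -
  let ?b = "corner_base (fst x)"
  have b: "?b \<in> corner_facets" "rot ?b \<in> corner_facets"
    using assms(2) by (auto intro: corner_base_closed rot_closed fst_geom_facets)
  then have P: "\<Psi> ?b \<in> corner_facets" "\<Psi> (rot ?b) = rot (\<Psi> ?b)" "rot (\<Psi> ?b) \<in> corner_facets"
     "\<Psi> (rot (rot ?b)) = rot (rot (\<Psi> ?b))"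
    using assms(1) by (auto simp: equivariant_def intro: rot_closed)
  have h: "height (rot ?b) = 1" "height (rot (rot ?b)) = 2"
    "height (rot (\<Psi> ?b)) = (height (\<Psi> ?b) + 1) mod 3"
    "height (rot (rot (\<Psi> ?b))) = (height (\<Psi> ?b) + 2) mod 3"
    using height_rot[OF b(1)] height_rot[OF b(2)] height_rot[OF P(1)] height_rot[OF P(3)]
    by (simp_all add: mod_simps add.commute)
  have 0: "height (\<Psi> ?b) mod 3 = height (\<Psi> ?b)"
    using height_range[of "\<Psi> ?b"] by simp
  consider "x = ?b" | "x = rot ?b" | "x = rot (rot ?b)"
    using corner_facet_cases[OF assms(2)] by blast
  then have "fst (\<Psi> x) = fst (\<Psi> ?b) \<and> height (\<Psi> x) = (height x + height (\<Psi> ?b)) mod 3"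
  proof cases
    case 1
    have "height (\<Psi> ?b) = (height ?b + height (\<Psi> ?b)) mod 3" using 0 by simp
    then show ?thesis using 1 by metis
  next
    case 2
    have "height (\<Psi> (rot ?b)) = (height (rot ?b) + height (\<Psi> ?b)) mod 3"
      "fst (\<Psi> (rot ?b)) = fst (\<Psi> ?b)" using h P by (simp_all add: add.commute)
    then show ?thesis using 2 by metis
  next
    case 3
    have "height (\<Psi> (rot (rot ?b))) = (height (rot (rot ?b)) + height (\<Psi> ?b)) mod 3"
      "fst (\<Psi> (rot (rot ?b))) = fst (\<Psi> ?b)" using h P by (simp_all add: add.commute)
    then show ?thesis using 3 by metis
  qed
  then show "fst (\<Psi> x) = fst (\<Psi> ?b)" "height (\<Psi> x) = (height x + height (\<Psi> ?b)) mod 3"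
    by auto
qed

lemma twist_cong:
  assumes "\<And>x. x \<in> corner_facets \<Longrightarrow> \<Psi> x = \<Psi>' x"
  shows "twist \<Psi> = twist \<Psi>'"
  unfolding twist_def using assms corner_base_closed by (metis (no_types, lifting) sum.cong)

lemma twist_comp:
  assumes "equivariant \<Psi>'" "equivariant \<Psi>"
    and bij: "bij_betw (\<lambda>c. fst (\<Psi> (corner_base c))) corners corners"
  shows "twist (\<lambda>x. \<Psi>' (\<Psi> x)) = (twist \<Psi>' + twist \<Psi>) mod 3"
proof -
  let ?p = "\<lambda>c. fst (\<Psi> (corner_base c))"
  have *: "height (\<Psi>' (\<Psi> (corner_base c))) =
      (height (\<Psi> (corner_base c)) + height (\<Psi>' (corner_base (?p c)))) mod 3" if "c \<in> corners" for c
    using that assms by (intro equivariant_height) (auto simp: equivariant_def corner_base_closed)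
  have "twist (\<lambda>x. \<Psi>' (\<Psi> x)) = (\<Sum>c\<in>corners.
      height (\<Psi> (corner_base c)) + height (\<Psi>' (corner_base (?p c)))) mod 3"
    unfolding twist_def by (subst mod_sum_eq[symmetric]) (simp add: * mod_sum_eq cong: sum.cong)
  also have "(\<Sum>c\<in>corners. height (\<Psi> (corner_base c)) + height (\<Psi>' (corner_base (?p c)))) =
      (\<Sum>c\<in>corners. height (\<Psi> (corner_base c))) + (\<Sum>c\<in>corners. height (\<Psi>' (corner_base c)))"
    using sum.reindex_bij_betw[OF bij, of "\<lambda>c. height (\<Psi>' (corner_base c))"]
    by (simp add: sum.distrib)
  finally show ?thesis
    by (simp add: twist_def mod_simps add.commute)
qed

lemma equivariant_turn_facet:
  assumes "legal_word w"
  shows "equivariant (turn_facet w)"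
proof -
  have *: "\<forall>m\<in>moves. \<forall>x\<in>corner_facets. case_prod slice_facet m (rot x) = rot (case_prod slice_facet m x)"
    unfolding enumerations by code_simp
  have "turn_facet w (rot x) = rot (turn_facet w x)" if "x \<in> corner_facets" for x
    using assms
  proof (induction w)
    case (Cons m w)
    then show ?case
      using * turn_facet_closed[of w x 3] that by simp
  qed simp
  then show ?thesis
    using assms turn_facet_closed[of w _ 3] by (simp add: equivariant_def)
qed

lemma twist_turn_facet:
  assumes "legal_word w"
  shows "twist (turn_facet w) = 0"
  using assms
proof (induction w)
  case Nil
  then show ?case by (simp add: twist_def)
next
  case (Cons m w)
  have "\<forall>m\<in>moves. sum_list (map (\<lambda>c. height (case_prod slice_facet m (corner_base c))) (cubie_list 3)) mod 3 = 0"
    unfolding enumerations by code_simp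
  moreover have "distinct (cubie_list 3)" by code_simp
  ultimately have "twist (turn_facet [m]) = 0"
    using Cons.prems by (simp add: twist_def cubies_list sum_list_distinct_conv_sum_set)
  moreover have "twist (\<lambda>x. turn_facet [m] (turn_facet w x)) = (twist (turn_facet [m]) + twist (turn_facet w)) mod 3"
    using Cons.prems bij_turn_cubie[of w 3]
    by (intro twist_comp equivariant_turn_facet) (auto simp: fst_turn_facet)
  ultimately show ?case
    using Cons by (simp add: comp_def)
qed

abbreviation swap :: "'a \<Rightarrow> 'a \<Rightarrow> 'a \<Rightarrow> 'a" where
  "swap \<equiv> Transposition.transpose"

section \<open>Generating permutations from a star of transpositions or 3-cycles\<close>

text \<open>Any transposition \<open>(x y)\<close> is \<open>(a x)(a y)(a x)\<close>, so the transpositions through a fixed point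
  \<open>a\<close> generate the symmetric group.\<close>

lemma permutes_star_induct [consumes 3, case_names id step]:
  assumes "p permutes X" "finite X" "a \<in> X"
    and id: "Q id"
    and step: "\<And>x q. x \<in> X \<Longrightarrow> q permutes X \<Longrightarrow> Q q \<Longrightarrow> Q (swap a x \<circ> q)"
  shows "Q p"
  using assms(1,2)
proof (induction rule: permutes_induct)
  case id
  show ?case by (rule assms(4))
next
  case (swap x y p)
  have per: "swap a x \<circ> q permutes X" if "x \<in> X" "q permutes X" for x q
    using that assms(3) by (intro permutes_compose permutes_swap_id)
  show ?case
  proof (cases "x = a \<or> y = a \<or> x = y")
    case True
    then consider "x = a" | "y = a" | "x = y" by blast
    then show ?thesis
      using swap step[of x p] step[of y p] by cases (simp_all add: transpose_commute comp_def)
  next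
    case False
    then have "swap x y = swap a x \<circ> swap a y \<circ> swap a x"
      by (auto simp: fun_eq_iff Transposition.transpose_def)
    then have "swap x y \<circ> p = swap a x \<circ> (swap a y \<circ> (swap a x \<circ> p))"
      by (simp add: comp_assoc)
    then show ?thesis
      using swap by (metis step per)
  qed
qed

text \<open>The alternating group is reached without speaking of signs: the set of permutations that lie
  in \<open>Q\<close> after possibly composing with \<open>(a b)\<close> is stable under every \<open>(a x)\<close>, because
  \<open>(a x)(a b)\<close> and its square \<open>(a b)(a x)\<close> lie in \<open>Q\<close>.\<close>

lemma three_cycles_star:
  assumes "p permutes X" "finite X" "a \<in> X" "a \<noteq> b"
    and id: "id \<in> Q"
    and comp: "\<And>f g. f \<in> Q \<Longrightarrow> g \<in> Q \<Longrightarrow> f \<circ> g \<in> Q"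
    and cyc: "\<And>x. x \<in> X - {a, b} \<Longrightarrow> swap a x \<circ> swap a b \<in> Q"
  shows "p \<in> Q \<or> swap a b \<circ> p \<in> Q"
  using assms(1-3)
proof (induction rule: permutes_star_induct)
  case id
  show ?case using assms(5) by blast
next
  case (step x q)
  consider "x = a" | "x = b" | "x \<in> X - {a, b}" using step by blast
  then show ?case
  proof cases
    case 1
    then show ?thesis using step by simp
  next
    case 2
    have "swap a b \<circ> (swap a b \<circ> q) = q" by (simp add: fun_eq_iff)
    then show ?thesis using step 2 by auto
  next
    case 3
    let ?r = "swap a x \<circ> swap a b"
    have "swap a b \<circ> (swap a x \<circ> q) = ?r \<circ> ?r \<circ> q"
      using 3 assms(4) by (auto simp: fun_eq_iff Transposition.transpose_def)
    moreover have "swap a x \<circ> q = ?r \<circ> (swap a b \<circ> q)"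
      by (simp add: fun_eq_iff)
    ultimately show ?thesis
      using step cyc[OF 3] comp by metis
  qed
qed


section \<open>Explicit words\<close>

definition word :: "(move \<times> nat) list \<Rightarrow> move list" where
  "word ps = concat (map (\<lambda>(m, k). replicate k m) ps)"

text \<open>The parity sequence known to solvers of the \<open>4\<times>4\<times>4\<close> cube, performed with inner slices
  only: it exchanges two edges and otherwise displaces centres only.\<close>

definition edge_swap :: "move list" where
  "edge_swap = word [((1, 1), 2), ((2, 3), 2), ((1, -1), 3), ((2, -3), 2), ((1, 1), 3), ((2, -3), 2),
     ((3, 3), 2), ((1, 1), 3), ((3, 3), 2), ((1, 1), 1), ((3, 3), 2), ((1, -1), 1), ((3, 3), 2),
     ((2, 3), 2), ((1, 1), 2)]"

text \<open>This is the commutator of \<open>X Y X\<^sup>-\<^sup>1\<close> and \<open>Z\<close>, where \<open>X\<close>, \<open>Y\<close>, \<open>Z\<close> are the moves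
  of the slices \<open>(1, -3)\<close>, \<open>(2, -1)\<close>, \<open>(2, 1)\<close>. The cubie \<open>(-3, 1, -1)\<close> is the only one
  displaced by both, and the commutator of two permutations whose supports meet in one point is a
  3-cycle.\<close>

definition centre_cycle :: "move list" where
  "centre_cycle = word [((1, -3), 1), ((2, -1), 1), ((1, -3), 3), ((2, 1), 1), ((1, -3), 1),
     ((2, -1), 3), ((1, -3), 3), ((2, 1), 3)]"

text \<open>As on the \<open>2\<times>2\<times>2\<close> cube, this word exchanges the positions of two corners. It may turn
  corners and displace edges and centres: that is corrected by the other words.\<close>

definition corner_swap :: "move list" where
  "corner_swap = word [((3, 3), 1), ((2, 3), 1), ((1, 3), 1), ((2, -3), 3), ((1, -3), 3)]"

text \<open>With \<open>Y\<close> the square of a commutator of two adjacent faces and \<open>U\<close> a turn of the upper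
  face, this is \<open>U Y U\<^sup>-\<^sup>1 Y\<^sup>-\<^sup>1\<close>. The only effect of \<open>Y\<close> on the upper face is to turn one
  corner, so the commutator turns two corners in opposite directions.\<close>

definition corner_twists :: "move list" where
  "corner_twists = word [((3, 3), 1), ((1, 3), 3), ((3, -3), 1), ((1, 3), 1), ((3, -3), 3),
     ((1, 3), 3), ((3, -3), 1), ((1, 3), 1), ((3, -3), 3), ((3, 3), 3), ((3, -3), 1), ((1, 3), 3),
     ((3, -3), 3), ((1, 3), 1), ((3, -3), 1), ((1, 3), 3), ((3, -3), 3), ((1, 3), 1)]"

abbreviation a_edge :: int3 where "a_edge \<equiv> (1, -3, 3)"
abbreviation b_edge :: int3 where "b_edge \<equiv> (-1, -3, 3)"
abbreviation a_centre :: int3 where "a_centre \<equiv> (-1, -1, 3)"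
abbreviation b_centre :: int3 where "b_centre \<equiv> (-1, 1, 3)"
abbreviation c_centre :: int3 where "c_centre \<equiv> (-3, 1, -1)"

text \<open>Positions of cubies are evaluated through facets; the zero vector serves as a dummy normal, which
  every rotation fixes.\<close>

lemma turn_cubie_eval: "turn_cubie w c = fst (turn_facet w (c, (0, 0, 0)))"
  by (simp add: fst_turn_facet)

lemma legal_words: "legal_word edge_swap" "legal_word centre_cycle" "legal_word corner_swap"
  "legal_word corner_twists"
proof -
  have "\<forall>w\<in>set [edge_swap, centre_cycle, corner_swap, corner_twists]. \<forall>m\<in>set w. m \<in> moves"
    unfolding enumerations by code_simp
  then show "legal_word edge_swap" "legal_word centre_cycle" "legal_word corner_swap"
    "legal_word corner_twists" by auto
qed

lemma edge_swap_edges: "c \<in> edges \<Longrightarrow> turn_cubie edge_swap c = swap a_edge b_edge c"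
proof -
  have "\<forall>c\<in>edges. turn_cubie edge_swap c = swap a_edge b_edge c"
    unfolding turn_cubie_eval enumerations by code_simp
  then show "c \<in> edges \<Longrightarrow> turn_cubie edge_swap c = swap a_edge b_edge c" by blast
qed

lemma edge_swap_corners: "x \<in> corner_facets \<Longrightarrow> turn_facet edge_swap x = x"
proof -
  have "\<forall>x\<in>corner_facets. turn_facet edge_swap x = x"
    unfolding turn_cubie_eval enumerations by code_simp
  then show "x \<in> corner_facets \<Longrightarrow> turn_facet edge_swap x = x" by blast
qed

lemma centre_cycle_centres:
  "c \<in> centres \<Longrightarrow> turn_cubie centre_cycle c = swap a_centre c_centre (swap a_centre b_centre c)"
proof -
  have "\<forall>c\<in>centres. turn_cubie centre_cycle c =
      swap a_centre c_centre (swap a_centre b_centre c)"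
    unfolding turn_cubie_eval enumerations by code_simp
  then show "c \<in> centres \<Longrightarrow> turn_cubie centre_cycle c =
      swap a_centre c_centre (swap a_centre b_centre c)" by blast
qed

lemma centre_cycle_others:
  "c \<in> edges \<Longrightarrow> turn_cubie centre_cycle c = c"
  "x \<in> corner_facets \<Longrightarrow> turn_facet centre_cycle x = x"
proof -
  have "\<forall>c\<in>edges. turn_cubie centre_cycle c = c"
    unfolding turn_cubie_eval enumerations by code_simp
  then show "c \<in> edges \<Longrightarrow> turn_cubie centre_cycle c = c" by blast
  have "\<forall>x\<in>corner_facets. turn_facet centre_cycle x = x"
    unfolding turn_cubie_eval enumerations by code_simp
  then show "x \<in> corner_facets \<Longrightarrow> turn_facet centre_cycle x = x" by blast
qed

lemma corner_swap_corners:
  "c \<in> corners \<Longrightarrow> turn_cubie corner_swap c = swap (-3, -3, 3) (-3, 3, 3) c"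
proof -
  have "\<forall>c\<in>corners. turn_cubie corner_swap c = swap (-3, -3, 3) (-3, 3, 3) c"
    unfolding turn_cubie_eval enumerations by code_simp
  then show "c \<in> corners \<Longrightarrow> turn_cubie corner_swap c = swap (-3, -3, 3) (-3, 3, 3) c" by blast
qed

lemma corner_twists_corners:
  "c \<in> corners \<Longrightarrow> turn_cubie corner_twists c = c"
  "x \<in> corner_facets \<Longrightarrow> fst x \<noteq> (3, -3, 3) \<Longrightarrow>
     turn_facet corner_twists x = (if fst x = (3, 3, 3) then rot x else x)"
proof -
  have *: "\<forall>x\<in>corner_facets. turn_facet corner_twists x =
      (if fst x = (3, 3, 3) then rot x else if fst x = (3, -3, 3) then rot (rot x) else x)"
    unfolding turn_cubie_eval enumerations by code_simp
  then show "x \<in> corner_facets \<Longrightarrow> fst x \<noteq> (3, -3, 3) \<Longrightarrow>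
     turn_facet corner_twists x = (if fst x = (3, 3, 3) then rot x else x)" by simp
  show "turn_cubie corner_twists c = c" if "c \<in> corners" for c
    using * corner_base_closed[OF that] fst_turn_facet[of corner_twists "corner_base c"]
    by (metis fst_corner_base fst_rot)
qed

text \<open>Stabilisers of one or two pieces are transitive on the remaining pieces of the same kind. Hence
  conjugates of a single explicit word yield all transpositions, 3-cycles or twists through the
  fixed pieces. The words come from a breadth-first search with the moves that leave the fixed
  pieces in place.\<close>

lemma reachable:
  "c \<in> edges - {a_edge} \<Longrightarrow> \<exists>u. legal_word u \<and> turn_cubie u a_edge = a_edge \<and> turn_cubie u b_edge = c"
  "c \<in> centres - {a_centre, b_centre} \<Longrightarrow> \<exists>u. legal_word u \<and> turn_cubie u a_centre = a_centre \<and>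
     turn_cubie u b_centre = b_centre \<and> turn_cubie u c_centre = c"
  "c \<in> corners - {(-3, -3, 3)} \<Longrightarrow> \<exists>u. legal_word u \<and> turn_cubie u (-3, -3, 3) = (-3, -3, 3) \<and>
     turn_cubie u (-3, 3, 3) = c"
  "c \<in> corners - {(3, -3, 3)} \<Longrightarrow> \<exists>u. legal_word u \<and> turn_cubie u (3, -3, 3) = (3, -3, 3) \<and>
     turn_cubie u (3, 3, 3) = c"
proof -
  let ?E = "[[], [(1, -1)], [(1, -1), (1, -1)], [(3, -3), (1, -1)], [(1, -1), (1, -1), (1, -1)],
    [(2, 3), (1, -1), (1, -1)], [(3, -3), (1, -1), (1, -1)], [(1, 3), (3, -3), (1, -1)],
    [(3, -3), (3, -3), (1, -1)], [(2, 3), (1, -1), (1, -1), (1, -1)],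
    [(1, -3), (2, 3), (1, -1), (1, -1)], [(2, 3), (2, 3), (1, -1), (1, -1)],
    [(3, 1), (2, 3), (1, -1), (1, -1)], [(1, -3), (3, -3), (1, -1), (1, -1)],
    [(3, -3), (3, -3), (1, -1), (1, -1)], [(1, 3), (1, 3), (3, -3), (1, -1)],
    [(3, -3), (3, -3), (3, -3), (1, -1)], [(1, 3), (2, 3), (1, -1), (1, -1), (1, -1)],
    [(1, -3), (1, -3), (2, 3), (1, -1), (1, -1)], [(3, 1), (3, 1), (2, 3), (1, -1), (1, -1)],
    [(1, -3), (1, -3), (3, -3), (1, -1), (1, -1)], [(3, -3), (3, -3), (3, -3), (1, -1), (1, -1)],
    [(1, 3), (1, 3), (2, 3), (1, -1), (1, -1), (1, -1)]] :: move list list"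
  let ?Z = "[[], [(1, -3)], [(3, -1)], [(1, -3), (1, -3)], [(3, 1), (1, -3)], [(3, -1), (3, -1)],
    [(1, -3), (1, -3), (1, -3)], [(3, 1), (1, -3), (1, -3)], [(3, 1), (3, 1), (1, -3)],
    [(1, 3), (3, -1), (3, -1)], [(3, -1), (3, -1), (3, -1)], [(3, -1), (1, -3), (1, -3), (1, -3)],
    [(1, 1), (3, 1), (1, -3), (1, -3)], [(3, 1), (3, 1), (1, -3), (1, -3)],
    [(3, 1), (3, 1), (3, 1), (1, -3)], [(3, -1), (1, 3), (3, -1), (3, -1)],
    [(1, 1), (3, -1), (3, -1), (3, -1)], [(1, 1), (3, -1), (1, -3), (1, -3), (1, -3)],
    [(3, 1), (3, 1), (3, 1), (1, -3), (1, -3)], [(1, 1), (3, 1), (3, 1), (3, 1), (1, -3)],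
    [(3, -3), (1, 1), (3, -1), (1, -3), (1, -3), (1, -3)],
    [(3, -3), (3, -3), (1, 1), (3, -1), (1, -3), (1, -3), (1, -3)]] :: move list list"
  let ?C = "[[], [(2, 3)], [(1, 3), (2, 3)], [(2, 3), (2, 3)], [(1, 3), (1, 3), (2, 3)],
    [(2, 3), (2, 3), (2, 3)], [(3, -3), (2, 3), (2, 3), (2, 3)]] :: move list list"
  let ?T = "[[], [(2, 3)], [(2, 3), (2, 3)], [(1, -3), (2, 3), (2, 3)], [(3, -3), (2, 3), (2, 3)],
    [(1, -3), (1, -3), (2, 3), (2, 3)], [(3, -3), (3, -3), (2, 3), (2, 3)]] :: move list list"
  have legal: "\<forall>u\<in>set (?E @ ?Z @ ?C @ ?T). \<forall>m\<in>set u. m \<in> moves"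
    unfolding moves_def by simp
  have E: "(\<forall>u\<in>set ?E. turn_cubie u a_edge = a_edge) \<and> edges - {a_edge} \<subseteq> set (map (\<lambda>u. turn_cubie u b_edge) ?E)"
    unfolding turn_cubie_eval enumerations by code_simp
  have Z: "(\<forall>u\<in>set ?Z. turn_cubie u a_centre = a_centre \<and> turn_cubie u b_centre = b_centre) \<and>
    centres - {a_centre, b_centre} \<subseteq> set (map (\<lambda>u. turn_cubie u c_centre) ?Z)"
    unfolding turn_cubie_eval enumerations by code_simp
  have C: "(\<forall>u\<in>set ?C. turn_cubie u (-3, -3, 3) = (-3, -3, 3)) \<and>
    corners - {(-3, -3, 3)} \<subseteq> set (map (\<lambda>u. turn_cubie u (-3, 3, 3)) ?C)"
    unfolding turn_cubie_eval enumerations by code_simp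
  have T: "(\<forall>u\<in>set ?T. turn_cubie u (3, -3, 3) = (3, -3, 3)) \<and>
    corners - {(3, -3, 3)} \<subseteq> set (map (\<lambda>u. turn_cubie u (3, 3, 3)) ?T)"
    unfolding turn_cubie_eval enumerations by code_simp
  have pick: "\<exists>u\<in>set us. f u = c" if "X \<subseteq> set (map f us)" "c \<in> X" for X c and f :: "move list \<Rightarrow> int3" and us
    using that by (auto simp only: set_map)
  have leg: "legal_word u" if "u \<in> set ?E \<union> set ?Z \<union> set ?C \<union> set ?T" for u
    using legal that unfolding set_append by blast
  show "\<exists>u. legal_word u \<and> turn_cubie u a_edge = a_edge \<and> turn_cubie u b_edge = c" if "c \<in> edges - {a_edge}"
    using pick[OF conjunct2[OF E] that] conjunct1[OF E] leg by blast
  show "\<exists>u. legal_word u \<and> turn_cubie u a_centre = a_centre \<and>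
     turn_cubie u b_centre = b_centre \<and> turn_cubie u c_centre = c" if "c \<in> centres - {a_centre, b_centre}"
    using pick[OF conjunct2[OF Z] that] conjunct1[OF Z] leg by blast
  show "\<exists>u. legal_word u \<and> turn_cubie u (-3, -3, 3) = (-3, -3, 3) \<and>
     turn_cubie u (-3, 3, 3) = c" if "c \<in> corners - {(-3, -3, 3)}"
    using pick[OF conjunct2[OF C] that] conjunct1[OF C] leg by blast
  show "\<exists>u. legal_word u \<and> turn_cubie u (3, -3, 3) = (3, -3, 3) \<and>
     turn_cubie u (3, 3, 3) = c" if "c \<in> corners - {(3, -3, 3)}"
    using pick[OF conjunct2[OF T] that] conjunct1[OF T] leg by blast
qed

section \<open>What the legal moves can do\<close>

lemma inj_swap: "inj u \<Longrightarrow> u (swap a b c) = swap (u a) (u b) (u c)"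
  by (auto simp: Transposition.transpose_def inj_eq)

lemma special_cubies:
  "a_edge \<in> edges" "a_centre \<in> centres" "b_centre \<in> centres" "c_centre \<in> centres" "(-3, -3, 3) \<in> corners"
  "(3, -3, 3) \<in> corners" "(3, 3, 3) \<in> corners"
  by (simp_all add: cubies_iff)

text \<open>Conjugates of \<open>edge_swap\<close> are all the transpositions through one edge, with no effect on
  corners.\<close>

lemma edges_realised:
  assumes "p permutes edges"
  shows "\<exists>w. legal_word w \<and> (\<forall>c\<in>edges. turn_cubie w c = p c) \<and> (\<forall>x\<in>corner_facets. turn_facet w x = x)"
  using assms finite_cubies special_cubies(1)
proof (induction rule: permutes_star_induct)
  case id
  show ?case by (rule exI[of _ "[]"]) simp
next
  case (step x q)
  then obtain w where w: "legal_word w" "\<forall>c\<in>edges. turn_cubie w c = q c" "\<forall>x\<in>corner_facets. turn_facet w x = x"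
    by blast
  show ?case
  proof (cases "x = a_edge")
    case True
    then show ?thesis using w by auto
  next
    case False
    with step reachable(1) obtain u where u: "legal_word u" "turn_cubie u a_edge = a_edge" "turn_cubie u b_edge = x"
      by blast
    have lu: "legal_word (undo u)" using u legal_undo by blast
    let ?w = "u @ edge_swap @ undo u @ w"
    have "turn_cubie ?w c = (swap a_edge x \<circ> q) c" if "c \<in> edges" for c
    proof -
      let ?d = "turn_cubie (undo u) (turn_cubie w c)"
      have "?d \<in> edges" using that w lu turn_cubie_closed by blast
      then have "turn_cubie ?w c = turn_cubie u (swap a_edge b_edge ?d)"
        by (simp add: edge_swap_edges)
      also have "\<dots> = swap a_edge x (turn_cubie w c)"
        using u inj_swap[OF inj_turn_cubie[OF u(1)]] turn_cubie_undo[OF u(1)] by metis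
      finally show ?thesis using w that by simp
    qed
    moreover have "turn_facet ?w y = y" if "y \<in> corner_facets" for y
    proof -
      have "turn_facet (undo u) y \<in> corner_facets" using that lu turn_facet_closed by blast
      then show ?thesis
        using that w by (simp add: edge_swap_corners turn_facet_undo[OF u(1)])
    qed
    moreover have "legal_word ?w"
      using u w lu legal_words by simp
    ultimately show ?thesis by blast
  qed
qed

text \<open>Only even permutations of the centres are reached without moving other pieces; \<open>q\<close> records
  the missing transposition. It is chosen between two centres of one face, so that it is an
  indistinguishable transformation.\<close>

lemma centres_realised:
  assumes "p permutes centres"
  shows "\<exists>w q. legal_word w \<and> q \<in> {id, swap a_centre b_centre} \<and> (\<forall>c\<in>centres. turn_cubie w c = q (p c)) \<and>
    (\<forall>c\<in>edges. turn_cubie w c = c) \<and> (\<forall>x\<in>corner_facets. turn_facet w x = x)"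
proof -
  define Q where "Q = {p. \<exists>w. legal_word w \<and> (\<forall>c\<in>centres. turn_cubie w c = p c) \<and>
    (\<forall>c\<in>edges. turn_cubie w c = c) \<and> (\<forall>x\<in>corner_facets. turn_facet w x = x)}"
  have "p \<in> Q \<or> swap a_centre b_centre \<circ> p \<in> Q"
    using assms finite_cubies special_cubies(2)
  proof (rule three_cycles_star)
    show "a_centre \<noteq> b_centre" by simp
    show "id \<in> Q"
      unfolding Q_def mem_Collect_eq by (rule exI[of _ "[]"]) simp
  next
    fix f g
    assume "f \<in> Q" "g \<in> Q"
    then obtain v w where
      v: "legal_word v" "\<forall>c\<in>centres. turn_cubie v c = f c" "\<forall>c\<in>edges. turn_cubie v c = c"
        "\<forall>x\<in>corner_facets. turn_facet v x = x"
      and w: "legal_word w" "\<forall>c\<in>centres. turn_cubie w c = g c" "\<forall>c\<in>edges. turn_cubie w c = c"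
        "\<forall>x\<in>corner_facets. turn_facet w x = x"
      unfolding Q_def by blast
    have "g c \<in> centres" if "c \<in> centres" for c
      using that w turn_cubie_closed[of w c 1] by auto
    then show "f \<circ> g \<in> Q"
      unfolding Q_def mem_Collect_eq using v w by (intro exI[of _ "v @ w"]) auto
  next
    fix x assume "x \<in> centres - {a_centre, b_centre}"
    from reachable(2)[OF this] obtain u where u: "legal_word u" "turn_cubie u a_centre = a_centre"
      "turn_cubie u b_centre = b_centre" "turn_cubie u c_centre = x" by blast
    have lu: "legal_word (undo u)" using u legal_undo by blast
    let ?w = "u @ centre_cycle @ undo u"
    have "turn_cubie ?w c = (swap a_centre x \<circ> swap a_centre b_centre) c" if "c \<in> centres" for c
    proof -
      let ?d = "turn_cubie (undo u) c"
      have "?d \<in> centres" using that lu turn_cubie_closed by blast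
      then have "turn_cubie ?w c = turn_cubie u (swap a_centre c_centre (swap a_centre b_centre ?d))"
        by (simp add: centre_cycle_centres)
      then show ?thesis
        using u inj_swap[OF inj_turn_cubie[OF u(1)]] turn_cubie_undo[OF u(1)] by (metis comp_apply)
    qed
    moreover have "turn_facet ?w y = y" if "y \<in> corner_facets" for y
    proof -
      have "turn_facet (undo u) y \<in> corner_facets" using that lu turn_facet_closed by blast
      then show ?thesis
        by (simp add: centre_cycle_others turn_facet_undo[OF u(1)])
    qed
    moreover have "turn_cubie ?w c = c" if "c \<in> edges" for c
    proof -
      have "turn_cubie (undo u) c \<in> edges" using that lu turn_cubie_closed by blast
      then show ?thesis
        by (simp add: centre_cycle_others turn_cubie_undo[OF u(1)])
    qed
    moreover have "legal_word ?w"
      using u lu legal_words by simp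
    ultimately show "swap a_centre x \<circ> swap a_centre b_centre \<in> Q"
      unfolding Q_def by blast
  qed
  then show ?thesis
  proof
    assume "p \<in> Q"
    then show ?thesis unfolding Q_def by (auto intro!: exI[of _ id])
  next
    assume "swap a_centre b_centre \<circ> p \<in> Q"
    then show ?thesis unfolding Q_def by (auto intro!: exI[of _ "swap a_centre b_centre"])
  qed
qed

lemma corner_positions_realised:
  assumes "p permutes corners"
  shows "\<exists>w. legal_word w \<and> (\<forall>c\<in>corners. turn_cubie w c = p c)"
  using assms finite_cubies special_cubies(5)
proof (induction rule: permutes_star_induct)
  case id
  show ?case by (rule exI[of _ "[]"]) simp
next
  case (step x q)
  let ?a = "(-3, -3, 3) :: int3"
  from step obtain w where w: "legal_word w" "\<forall>c\<in>corners. turn_cubie w c = q c"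
    by blast
  show ?case
  proof (cases "x = ?a")
    case True
    then show ?thesis using w by auto
  next
    case False
    with step reachable(3) obtain u where u: "legal_word u" "turn_cubie u ?a = ?a" "turn_cubie u (-3, 3, 3) = x"
      by blast
    have lu: "legal_word (undo u)" using u legal_undo by blast
    let ?w = "u @ corner_swap @ undo u @ w"
    have "turn_cubie ?w c = (swap ?a x \<circ> q) c" if "c \<in> corners" for c
    proof -
      let ?d = "turn_cubie (undo u) (turn_cubie w c)"
      have "?d \<in> corners" using that w lu turn_cubie_closed by blast
      then have "turn_cubie ?w c = turn_cubie u (swap ?a (-3, 3, 3) ?d)"
        by (simp add: corner_swap_corners)
      also have "\<dots> = swap ?a x (turn_cubie w c)"
        using u inj_swap[OF inj_turn_cubie[OF u(1)]] turn_cubie_undo[OF u(1)] by metis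
      finally show ?thesis using w that by simp
    qed
    moreover have "legal_word ?w"
      using u w lu legal_words by simp
    ultimately show ?thesis by blast
  qed
qed

text \<open>The rotation at \<open>(3, -3, 3)\<close> is left open: it is forced by the others, as the twist
  of a word is zero.\<close>

definition twists_realised :: "(int3 \<Rightarrow> int) \<Rightarrow> bool" where
  "twists_realised k \<longleftrightarrow> (\<exists>v. legal_word v \<and> (\<forall>c\<in>corners. turn_cubie v c = c) \<and>
     (\<forall>c\<in>corners - {(3, -3, 3)}. height (turn_facet v (corner_base c)) = k c mod 3))"

lemma twists_realised_add1:
  assumes "twists_realised k" "a \<in> corners - {(3, -3, 3)}"
  shows "twists_realised (k(a := k a + 1))"
proof -
  from assms(1) obtain v where v: "legal_word v" "\<forall>c\<in>corners. turn_cubie v c = c"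
    "\<forall>c\<in>corners - {(3, -3, 3)}. height (turn_facet v (corner_base c)) = k c mod 3"
    unfolding twists_realised_def by blast
  from reachable(4)[OF assms(2)] obtain u where u: "legal_word u" "turn_cubie u (3, -3, 3) = (3, -3, 3)"
    "turn_cubie u (3, 3, 3) = a" by blast
  have lu: "legal_word (undo u)" using u legal_undo by blast
  let ?s = "u @ corner_twists @ undo u"
  have pos: "turn_cubie ?s c = c" if "c \<in> corners" for c
  proof -
    have "turn_cubie (undo u) c \<in> corners" using that lu turn_cubie_closed by blast
    then show ?thesis by (simp add: corner_twists_corners(1) turn_cubie_undo[OF u(1)])
  qed
  have s: "turn_facet ?s y = (if fst y = a then rot y else y)"
    if y: "y \<in> corner_facets" "fst y \<noteq> (3, -3, 3)" for y
  proof -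
    let ?z = "turn_facet (undo u) y"
    have z: "?z \<in> corner_facets" using y lu turn_facet_closed by blast
    have uz: "turn_facet u ?z = y" using turn_facet_undo[OF u(1)] by blast
    have "turn_cubie u (fst ?z) = fst y" using uz fst_turn_facet by metis
    then have "fst ?z \<noteq> (3, -3, 3)" "fst ?z = (3, 3, 3) \<longleftrightarrow> fst y = a"
      using u(2,3) y(2) inj_eq[OF inj_turn_cubie[OF u(1)]] by metis+
    then have "turn_facet corner_twists ?z = (if fst y = a then rot ?z else ?z)"
      using corner_twists_corners(2)[OF z] by simp
    moreover have "turn_facet u (rot ?z) = rot y"
      using equivariant_turn_facet[OF u(1)] z uz by (simp add: equivariant_def)
    ultimately show ?thesis using uz by simp
  qed
  have "height (turn_facet (?s @ v) (corner_base c)) = (k(a := k a + 1)) c mod 3"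
    if c: "c \<in> corners - {(3, -3, 3)}" for c
  proof -
    let ?y = "turn_facet v (corner_base c)"
    have y: "?y \<in> corner_facets" "fst ?y = c"
      using c v turn_facet_closed[of v "corner_base c" 3] corner_base_closed[of c] by (auto simp: fst_turn_facet)
    have "turn_facet (?s @ v) (corner_base c) = turn_facet ?s ?y" by simp
    also have "\<dots> = (if c = a then rot ?y else ?y)" using s[of ?y] y c by simp
    finally show ?thesis
      using v(3) c height_rot[OF y(1)] by (auto simp: mod_simps)
  qed
  moreover have "turn_cubie (?s @ v) c = c" if "c \<in> corners" for c
    using pos[OF that] v(2) that by simp
  moreover have "legal_word (?s @ v)"
    using u v lu legal_words by simp
  ultimately show ?thesis
    unfolding twists_realised_def by blast
qed

lemma twists_realised_all: "twists_realised (\<lambda>c. int (k c))"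
proof -
  have add: "twists_realised (l(a := l a + int n))"
    if "twists_realised l" "a \<in> corners - {(3, -3, 3)}" for l a n
  proof (induction n)
    case 0
    then show ?case using that by simp
  next
    case (Suc n)
    let ?l = "l(a := l a + int n)"
    have "?l(a := ?l a + 1) = l(a := l a + int (Suc n))" by (simp add: fun_eq_iff)
    with twists_realised_add1[OF Suc that(2)] show ?case by metis
  qed
  have "twists_realised (\<lambda>c. if c \<in> F then int (k c) else 0)" if "finite F" "F \<subseteq> corners - {(3, -3, 3)}" for F
    using that
  proof (induction F rule: finite_induct)
    case empty
    have "twists_realised (\<lambda>c. 0)"
      unfolding twists_realised_def by (rule exI[of _ "[]"]) simp
    then show ?case by simp
  next
    case (insert a F)
    let ?l = "\<lambda>c. if c \<in> F then int (k c) else 0"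
    have "twists_realised (?l(a := ?l a + int (k a)))"
      using insert by (intro add) auto
    moreover have "?l(a := ?l a + int (k a)) = (\<lambda>c. if c \<in> insert a F then int (k c) else 0)"
      using insert by auto
    ultimately show ?case by simp
  qed
  from this[of "corners - {(3, -3, 3)}"] show ?thesis
    by (simp add: twists_realised_def)
qed

text \<open>Position the corners, then correct the rotations at all corners but \<open>(3, -3, 3)\<close>. The
  rotation of the last corner is right automatically, both twists being zero.\<close>

lemma corners_realised:
  assumes eq: "equivariant \<Psi>" and bij: "bij_betw (\<lambda>c. fst (\<Psi> (corner_base c))) corners corners"
    and twist: "twist \<Psi> = 0"
  shows "\<exists>w. legal_word w \<and> (\<forall>x\<in>corner_facets. turn_facet w x = \<Psi> x)"
proof -
  let ?p = "\<lambda>c. if c \<in> corners then fst (\<Psi> (corner_base c)) else c"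
  have "bij_betw ?p corners corners \<longleftrightarrow> bij_betw (\<lambda>c. fst (\<Psi> (corner_base c))) corners corners"
    by (rule bij_betw_cong) simp
  with bij have "?p permutes corners"
    by (intro bij_imp_permutes) auto
  from corner_positions_realised[OF this] obtain w where
    w: "legal_word w" "\<forall>c\<in>corners. turn_cubie w c = fst (\<Psi> (corner_base c))" by auto
  define k where "k c = nat ((height (\<Psi> (corner_base c)) - height (turn_facet w (corner_base c))) mod 3)" for c
  from twists_realised_all[of k] obtain v where v: "legal_word v" "\<forall>c\<in>corners. turn_cubie v c = c"
    "\<forall>c\<in>corners - {(3, -3, 3)}. height (turn_facet v (corner_base c)) = int (k c) mod 3"
    unfolding twists_realised_def by blast
  have wv: "legal_word (w @ v)" using w v by simp
  have fst_wv: "fst (turn_facet (w @ v) (corner_base c)) = fst (\<Psi> (corner_base c))" if "c \<in> corners" for c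
    using that v(2) w(2) by (simp add: fst_turn_facet)
  have height_mod: "height x mod 3 = height x" for x
    using height_range[of x] by simp
  have h: "height (turn_facet (w @ v) (corner_base c)) = height (\<Psi> (corner_base c))"
    if c: "c \<in> corners - {(3, -3, 3)}" for c
  proof -
    let ?y = "turn_facet v (corner_base c)"
    have y: "?y \<in> corner_facets" "fst ?y = c"
      using c v turn_facet_closed[of v "corner_base c" 3] corner_base_closed[of c] by (auto simp: fst_turn_facet)
    have "height (turn_facet (w @ v) (corner_base c)) =
        (height ?y + height (turn_facet w (corner_base c))) mod 3"
      using equivariant_height(2)[OF equivariant_turn_facet[OF w(1)] y(1)] y(2) by simp
    also have "\<dots> = height (\<Psi> (corner_base c)) mod 3"
      using v(3) c by (simp add: k_def mod_simps)
    finally show ?thesis by (simp add: height_mod)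
  qed
  have all: "height (turn_facet (w @ v) (corner_base c)) = height (\<Psi> (corner_base c))"
    if c: "c \<in> corners" for c
  proof (cases "c = (3, -3, 3)")
    case True
    let ?S = "\<lambda>f. \<Sum>c\<in>corners - {(3, -3, 3)}. height (f (corner_base c))"
    have split: "twist f = (height (f (corner_base c)) + ?S f) mod 3" for f
      unfolding twist_def using c True by (simp add: sum.remove[of corners "(3, -3, 3)"])
    have "?S (turn_facet (w @ v)) = ?S \<Psi>"
      using h by (intro sum.cong) auto
    with split[of "turn_facet (w @ v)"] split[of \<Psi>] twist twist_turn_facet[OF wv]
    have "(height (turn_facet (w @ v) (corner_base c)) + ?S \<Psi>) mod 3 =
        (height (\<Psi> (corner_base c)) + ?S \<Psi>) mod 3" by metis
    moreover have "i mod 3 = j mod 3" if "(i + s) mod 3 = (j + s) mod 3" for i j s :: int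
      using that by presburger
    ultimately have "height (turn_facet (w @ v) (corner_base c)) mod 3 = height (\<Psi> (corner_base c)) mod 3"
      by blast
    then show ?thesis by (simp only: height_mod)
  next
    case False
    then show ?thesis using h c by blast
  qed
  have "turn_facet (w @ v) x = \<Psi> x" if x: "x \<in> corner_facets" for x
  proof (intro corner_facet_eqI)
    have c: "fst x \<in> corners" using x fst_geom_facets by blast
    show "turn_facet (w @ v) x \<in> corner_facets" using wv x turn_facet_closed by blast
    show "\<Psi> x \<in> corner_facets" using eq x by (simp add: equivariant_def)
    show "fst (turn_facet (w @ v) x) = fst (\<Psi> x)"
      using equivariant_height(1)[OF equivariant_turn_facet[OF wv] x] equivariant_height(1)[OF eq x]
        fst_wv[OF c] by simp
    show "height (turn_facet (w @ v) x) = height (\<Psi> x)"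
      using equivariant_height(2)[OF equivariant_turn_facet[OF wv] x] equivariant_height(2)[OF eq x]
        all[OF c] by simp
  qed
  with wv show ?thesis by blast
qed

text \<open>Corners first, by words that may spoil edges and centres; then edges, by words that may spoil
  centres; then centres, as far as their parity permits. The last word is performed on the left, so
  that \<open>q\<close> acts on the left of the permutation of centres, like the indistinguishable
  transformations.\<close>

lemma all_realised:
  assumes \<sigma>: "\<sigma> permutes edges" and \<phi>: "\<phi> permutes centres"
    and \<Psi>: "equivariant \<Psi>" "bij_betw (\<lambda>c. fst (\<Psi> (corner_base c))) corners corners" "twist \<Psi> = 0"
  shows "\<exists>w q. legal_word w \<and> q \<in> {id, swap a_centre b_centre} \<and> (\<forall>c\<in>edges. turn_cubie w c = \<sigma> c) \<and>
    (\<forall>x\<in>corner_facets. turn_facet w x = \<Psi> x) \<and> (\<forall>c\<in>centres. q (turn_cubie w c) = \<phi> c)"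
proof -
  have per: "(\<lambda>c. if c \<in> cubies k then turn_cubie w c else c) permutes cubies k" if "legal_word w" for w k
  proof -
    have "bij_betw (\<lambda>c. if c \<in> cubies k then turn_cubie w c else c) (cubies k) (cubies k) \<longleftrightarrow>
        bij_betw (turn_cubie w) (cubies k) (cubies k)"
      by (rule bij_betw_cong) simp
    with bij_turn_cubie[OF that] show ?thesis
      by (intro bij_imp_permutes) auto
  qed
  obtain w1 where w1: "legal_word w1" "\<forall>x\<in>corner_facets. turn_facet w1 x = \<Psi> x"
    using corners_realised[OF \<Psi>] by blast
  let ?v1 = "\<lambda>c. if c \<in> edges then turn_cubie (undo w1) c else c"
  have "?v1 \<circ> \<sigma> permutes edges"
    using permutes_compose[OF \<sigma> per[OF legal_undo[OF w1(1)]]] .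
  from edges_realised[OF this] obtain w2 where w2: "legal_word w2"
    "\<forall>c\<in>edges. turn_cubie w2 c = ?v1 (\<sigma> c)" "\<forall>x\<in>corner_facets. turn_facet w2 x = x" by auto
  have w12: "legal_word (w1 @ w2)" using w1 w2 by simp
  let ?v2 = "\<lambda>c. if c \<in> centres then turn_cubie (undo (w1 @ w2)) c else c"
  \<comment> \<open>The effect of the first two words on the centres is arbitrary; the third one corrects it.\<close>
  have "\<phi> \<circ> ?v2 permutes centres"
    using permutes_compose[OF per[OF legal_undo[OF w12]] \<phi>] .
  from centres_realised[OF this] obtain w3 q where w3: "legal_word w3" "q \<in> {id, swap a_centre b_centre}"
    "\<forall>c\<in>centres. turn_cubie w3 c = q (\<phi> (?v2 c))"
    "\<forall>c\<in>edges. turn_cubie w3 c = c" "\<forall>x\<in>corner_facets. turn_facet w3 x = x" by auto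
  let ?w = "w3 @ w1 @ w2"
  have "turn_cubie ?w c = \<sigma> c" if "c \<in> edges" for c
  proof -
    have \<sigma>c: "\<sigma> c \<in> edges" using that by (simp add: permutes_in_image[OF \<sigma>])
    then have "turn_cubie (w1 @ w2) c = \<sigma> c"
      using w2(2) that by (simp add: turn_cubie_undo[OF w1(1)])
    then show ?thesis using w3(4) \<sigma>c by simp
  qed
  moreover have "turn_facet ?w x = \<Psi> x" if "x \<in> corner_facets" for x
    using that w1 w2 w3 \<Psi>(1) by (simp add: equivariant_def)
  moreover have "q (turn_cubie ?w c) = \<phi> c" if "c \<in> centres" for c
  proof -
    have "turn_cubie (w1 @ w2) c \<in> centres" using that w12 turn_cubie_closed by blast
    then have "turn_cubie ?w c = q (\<phi> c)"
      using w3(3) turn_cubie_undo(1)[OF w12, of c] by simp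
    then show ?thesis using w3(2) by auto
  qed
  moreover have "legal_word ?w" using w1 w2 w3 by simp
  ultimately show ?thesis using w3(2) by blast
qed

section \<open>The monoid of bundle automorphisms\<close>

text \<open>The record of a bundle does not enforce that the facets lie over its pieces and are stable
  under the action; both are needed to compose extensional bundle maps.\<close>

definition closed_bundle :: "('p, 'l) facet_bundle \<Rightarrow> bool" where
  "closed_bundle A \<longleftrightarrow> (\<forall>x\<in>facets A. fst x \<in> pieces A \<and> gen A x \<in> facets A)"

lemma bundle_isoI:
  assumes "f \<in> extensional (pieces A)" "bij_betw f (pieces A) (pieces B)"
    and "F \<in> extensional (facets A)" "bij_betw F (facets A) (facets B)"
    and "closed_bundle A"
    and "\<And>x. x \<in> facets A \<Longrightarrow> fst (F x) = f (fst x)"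
    and "\<And>x. x \<in> facets A \<Longrightarrow> F (gen A x) = gen B (F x)"
  shows "(f, F) \<in> bundle_iso A B"
proof -
  have "(gen A ^^ m) x \<in> facets A \<and> F ((gen A ^^ m) x) = (gen B ^^ m) (F x)"
    if "x \<in> facets A" for m x
    by (induction m) (use assms(5,7) that in \<open>auto simp: closed_bundle_def\<close>)
  then show ?thesis
    using assms by (simp add: bundle_iso_def)
qed

lemma bundle_isoD:
  assumes "(f, F) \<in> bundle_iso A B"
  shows "f \<in> extensional (pieces A)" "bij_betw f (pieces A) (pieces B)"
    "F \<in> extensional (facets A)" "bij_betw F (facets A) (facets B)"
    "x \<in> facets A \<Longrightarrow> fst (F x) = f (fst x)" "x \<in> facets A \<Longrightarrow> F (gen A x) = gen B (F x)"
proof -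
  have "\<forall>m. \<forall>x\<in>facets A. F ((gen A ^^ m) x) = (gen B ^^ m) (F x)"
    using assms by (simp add: bundle_iso_def)
  from this[rule_format, of x 1] show "x \<in> facets A \<Longrightarrow> F (gen A x) = gen B (F x)" by simp
qed (use assms in \<open>auto simp: bundle_iso_def\<close>)

lemma bundle_iso_funcset:
  assumes "(f, F) \<in> bundle_iso A B"
  shows "f \<in> pieces A \<rightarrow> pieces B" "F \<in> facets A \<rightarrow> facets B"
  using bundle_isoD(2,4)[OF assms] by (auto dest: bij_betw_apply)

lemma bundle_comp_iso:
  assumes "closed_bundle A" "f \<in> bundle_iso A B" "g \<in> bundle_iso B C"
  shows "bundle_comp A g f \<in> bundle_iso A C"
proof -
  obtain f1 F g1 G where eq: "f = (f1, F)" "g = (g1, G)" by (metis prod.exhaust)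
  note f = assms(2)[unfolded eq] and g = assms(3)[unfolded eq]
  have F: "F x \<in> facets B" if "x \<in> facets A" for x
    using that bundle_iso_funcset(2)[OF f] by blast
  have "(compose (pieces A) g1 f1, compose (facets A) G F) \<in> bundle_iso A C"
  proof (rule bundle_isoI)
    show "bij_betw (compose (pieces A) g1 f1) (pieces A) (pieces C)"
      "bij_betw (compose (facets A) G F) (facets A) (facets C)"
      using bundle_isoD[OF f] bundle_isoD[OF g] by (auto intro: bij_betw_compose)
    fix x assume x: "x \<in> facets A"
    then have A: "fst x \<in> pieces A" "gen A x \<in> facets A"
      using assms(1) by (auto simp: closed_bundle_def)
    show "fst (compose (facets A) G F x) = compose (pieces A) g1 f1 (fst x)"
      using x A F by (simp add: compose_eq bundle_isoD(5)[OF f] bundle_isoD(5)[OF g])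
    show "compose (facets A) G F (gen A x) = gen C (compose (facets A) G F x)"
      using x A F by (simp add: compose_eq bundle_isoD(6)[OF f] bundle_isoD(6)[OF g])
  qed (use assms(1) in auto)
  then show ?thesis
    by (simp add: eq bundle_comp_def)
qed

lemma bundle_comp_assoc:
  assumes "f \<in> bundle_iso A B"
  shows "bundle_comp A (bundle_comp B k g) f = bundle_comp A k (bundle_comp A g f)"
  using assms bundle_iso_funcset[of "fst f" "snd f" A B]
  by (auto simp: bundle_comp_def compose_assoc split: prod.splits)

lemma bundle_id_iso:
  assumes "closed_bundle A"
  shows "bundle_id A \<in> bundle_iso A A"
  unfolding bundle_id_def
  using assms by (intro bundle_isoI) (auto simp: closed_bundle_def bij_betw_def inj_on_def)

lemma bundle_comp_id:
  assumes "f \<in> bundle_iso A B"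
  shows "bundle_comp A f (bundle_id A) = f" "bundle_comp A (bundle_id B) f = f"
proof -
  obtain f1 F where eq: "f = (f1, F)" by fastforce
  note f = assms[unfolded eq]
  show "bundle_comp A f (bundle_id A) = f" "bundle_comp A (bundle_id B) f = f"
    using bundle_isoD(1,3)[OF f] bundle_iso_funcset[OF f]
    by (auto simp: eq bundle_comp_def bundle_id_def intro: compose_Id Id_compose)
qed

lemma bundle_comp_cancel:
  assumes "k \<in> bundle_iso A B" "a \<in> bundle_iso A A" "b \<in> bundle_iso A A"
    and "bundle_comp A k a = bundle_comp A k b"
  shows "a = b"
proof -
  have *: "f = g" if "compose X h f = compose X h g" "inj_on h X" "f \<in> X \<rightarrow> X" "g \<in> X \<rightarrow> X"
    "f \<in> extensional X" "g \<in> extensional X" for X :: "'x set" and h :: "'x \<Rightarrow> 'y" and f g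
  proof (rule extensionalityI[OF that(5,6)])
    fix x assume x: "x \<in> X"
    with fun_cong[OF that(1), of x] have "h (f x) = h (g x)" by (simp add: compose_eq)
    with x that show "f x = g x" by (meson PiE inj_onD)
  qed
  obtain k1 K a1 F b1 G where eq: "k = (k1, K)" "a = (a1, F)" "b = (b1, G)" by (metis prod.exhaust)
  note k = assms(1)[unfolded eq] and a = assms(2)[unfolded eq] and b = assms(3)[unfolded eq]
  have "compose (pieces A) k1 a1 = compose (pieces A) k1 b1" "compose (facets A) K F = compose (facets A) K G"
    using assms(4) by (auto simp: eq bundle_comp_def)
  then have "a1 = b1" "F = G"
    using bundle_isoD(2,4)[OF k] bundle_isoD(1,3)[OF a] bundle_isoD(1,3)[OF b]
      bundle_iso_funcset[OF a] bundle_iso_funcset[OF b] *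
    by (metis bij_betw_imp_inj_on)+
  then show ?thesis by (simp add: eq)
qed

lemma bundle_inv_cancel:
  assumes "closed_bundle A" "f \<in> bundle_iso A B"
  shows "k \<in> bundle_iso A C \<Longrightarrow> bundle_comp A (bundle_comp B k (bundle_inv A B f)) f = k"
    and "bundle_comp B f (bundle_inv A B f) = bundle_id B"
proof -
  obtain f1 F where eq: "f = (f1, F)" by fastforce
  note f = assms(2)[unfolded eq]
  have *: "compose X (compose Y h (restrict (inv_into X g) Y)) g = h"
    if "bij_betw g X Y" "h \<in> extensional X" for g :: "'x \<Rightarrow> 'y" and h :: "'x \<Rightarrow> 'z" and X Y
  proof
    fix x
    show "compose X (compose Y h (restrict (inv_into X g) Y)) g x = h x"
      using that by (cases "x \<in> X")
        (auto simp: compose_def bij_betw_def extensional_def inv_into_f_f)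
  qed
  have **: "compose Y g (restrict (inv_into X g) Y) = (\<lambda>y\<in>Y. y)" if "bij_betw g X Y"
    for g :: "'x \<Rightarrow> 'y" and X Y
    using that by (auto simp: compose_def bij_betw_def f_inv_into_f intro!: restrict_ext)
  show "bundle_comp A (bundle_comp B k (bundle_inv A B f)) f = k" if "k \<in> bundle_iso A C"
    using that bundle_isoD(2,4)[OF f]
    by (cases k) (auto simp: eq bundle_comp_def bundle_inv_def * bundle_isoD(1,3))
  show "bundle_comp B f (bundle_inv A B f) = bundle_id B"
    using bundle_isoD(2,4)[OF f] by (simp add: eq bundle_comp_def bundle_inv_def bundle_id_def **)
qed

text \<open>This transports well-formedness from the geometric to the material bundle through the solved
  state.\<close>

lemma closed_bundle_iso:
  assumes "closed_bundle A" "f \<in> bundle_iso A B"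
  shows "closed_bundle B"
proof -
  obtain f1 F where eq: "f = (f1, F)" by fastforce
  note f = assms(2)[unfolded eq]
  show ?thesis
    unfolding closed_bundle_def
  proof
    fix y assume "y \<in> facets B"
    then have "y \<in> F ` facets A"
      using bundle_isoD(4)[OF f] by (simp add: bij_betw_def)
    then obtain x where x: "x \<in> facets A" "y = F x" by blast
    moreover from x have "fst x \<in> pieces A" "gen A x \<in> facets A"
      using assms(1) by (auto simp: closed_bundle_def)
    ultimately show "fst y \<in> pieces B \<and> gen B y \<in> facets B"
      using bundle_isoD(5,6)[OF f x(1)] bundle_iso_funcset[OF f] by (metis PiE)
  qed
qed

lemma monoid_bundle_aut:
  assumes "closed_bundle A"
  shows "monoid (bundle_aut A)"
  using assms
  by (intro monoidI)
    (auto simp: bundle_aut_def bundle_comp_iso bundle_id_iso bundle_comp_assoc bundle_comp_id)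

lemma finite_bundle_iso:
  assumes "finite (pieces A)" "finite (facets A)" "finite (pieces B)" "finite (facets B)"
  shows "finite (bundle_iso A B)"
proof (rule finite_subset)
  show "bundle_iso A B \<subseteq> (pieces A \<rightarrow>\<^sub>E pieces B) \<times> (facets A \<rightarrow>\<^sub>E facets B)"
  proof
    fix f assume f: "f \<in> bundle_iso A B"
    obtain f1 F where eq: "f = (f1, F)" by fastforce
    show "f \<in> (pieces A \<rightarrow>\<^sub>E pieces B) \<times> (facets A \<rightarrow>\<^sub>E facets B)"
      using bundle_isoD(1,3)[OF f[unfolded eq]] bundle_iso_funcset[OF f[unfolded eq]]
      by (simp add: eq PiE_def)
  qed
  show "finite ((pieces A \<rightarrow>\<^sub>E pieces B) \<times> (facets A \<rightarrow>\<^sub>E facets B))"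
    using assms by (intro finite_cartesian_product finite_PiE) auto
qed


section \<open>Geometric transformations\<close>

lemma closed_ArGeom: "closed_bundle ArGeom"
  by (simp add: closed_bundle_def exchange_edge flip_closed fst_geom_facets)

lemma closed_SomGeom: "closed_bundle SomGeom"
  by (simp add: closed_bundle_def rot_closed fst_geom_facets)

lemma T_geom_carrier:
  "carrier T_geom = bundle_iso ArGeom ArGeom \<times> bundle_iso SomGeom SomGeom \<times> Bij centres"
  by (simp add: T_geom_def bundle_aut_def BijGroup_def DirProd_def CentGeom_def)

lemma T_geom_mult:
  assumes "p \<in> Bij centres" "p' \<in> Bij centres"
  shows "(a, b, p) \<otimes>\<^bsub>T_geom\<^esub> (a', b', p') =
    (bundle_comp ArGeom a a', bundle_comp SomGeom b b', compose centres p p')"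
  using assms by (simp add: T_geom_def bundle_aut_def BijGroup_def DirProd_def CentGeom_def)

lemma T_geom_one: "\<one>\<^bsub>T_geom\<^esub> = (bundle_id ArGeom, bundle_id SomGeom, \<lambda>c\<in>centres. c)"
  by (simp add: T_geom_def bundle_aut_def BijGroup_def CentGeom_def)

lemma monoid_T_geom: "monoid T_geom"
  unfolding T_geom_def
  by (intro DirProd_monoid monoid_bundle_aut closed_ArGeom closed_SomGeom
      group.is_monoid group_BijGroup)

lemma T'_geom_iff:
  "((\<sigma>, \<Phi>), (\<tau>, \<Psi>), \<phi>) \<in> T'_geom \<longleftrightarrow> (\<sigma>, \<Phi>) \<in> bundle_iso ArGeom ArGeom \<and>
     (\<tau>, \<Psi>) \<in> bundle_iso SomGeom SomGeom \<and> \<phi> \<in> Bij centres \<and>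
     (\<forall>c\<in>edges. \<Phi> (edge_base c) = edge_base (\<sigma> c))"
proof -
  have "(\<forall>c\<in>edges. \<Phi> (edge_section c) = edge_section (\<sigma> c)) \<longleftrightarrow>
      (\<forall>c\<in>edges. \<Phi> (edge_base c) = edge_base (\<sigma> c))" if "(\<sigma>, \<Phi>) \<in> bundle_iso ArGeom ArGeom"
    using bundle_iso_funcset(1)[OF that] by (simp add: edge_section_eq Pi_iff)
  then show ?thesis
    by (auto simp: T'_geom_def T_geom_carrier)
qed

lemma T'_geom_carrier: "t \<in> T'_geom \<Longrightarrow> t \<in> carrier T_geom"
  by (auto simp: T'_geom_def)

definition twist_of :: "tgeom \<Rightarrow> int" where
  "twist_of t = twist (snd (fst (snd t)))"

lemma SomGeom_automorphism:
  assumes "(\<tau>, \<Psi>) \<in> bundle_iso SomGeom SomGeom"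
  shows "equivariant \<Psi>" "bij_betw (\<lambda>c. fst (\<Psi> (corner_base c))) corners corners"
proof -
  have 1: "\<Psi> x \<in> corner_facets" "\<Psi> (rot x) = rot (\<Psi> x)" "fst (\<Psi> x) = \<tau> (fst x)"
    if "x \<in> corner_facets" for x
    using that bundle_isoD(5,6)[OF assms] bundle_iso_funcset(2)[OF assms] by auto
  then show "equivariant \<Psi>" by (simp add: equivariant_def)
  have "bij_betw (\<lambda>c. fst (\<Psi> (corner_base c))) corners corners \<longleftrightarrow> bij_betw \<tau> corners corners"
    by (rule bij_betw_cong) (simp add: 1 corner_base_closed)
  then show "bij_betw (\<lambda>c. fst (\<Psi> (corner_base c))) corners corners"
    using bundle_isoD(2)[OF assms] by simp
qed

lemma T'_geom_mult:
  assumes "s \<in> T'_geom" "t \<in> T'_geom"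
  shows "s \<otimes>\<^bsub>T_geom\<^esub> t \<in> T'_geom"
    and "twist_of (s \<otimes>\<^bsub>T_geom\<^esub> t) = (twist_of s + twist_of t) mod 3"
proof -
  obtain \<sigma> \<Phi> \<tau> \<Psi> \<phi> \<sigma>' \<Phi>' \<tau>' \<Psi>' \<phi>' where eq: "s = ((\<sigma>, \<Phi>), (\<tau>, \<Psi>), \<phi>)" "t = ((\<sigma>', \<Phi>'), (\<tau>', \<Psi>'), \<phi>')"
    by (metis prod.exhaust)
  note s = assms(1)[unfolded eq T'_geom_iff] and t = assms(2)[unfolded eq T'_geom_iff]
  have st: "s \<otimes>\<^bsub>T_geom\<^esub> t = ((compose edges \<sigma> \<sigma>', compose edge_facets \<Phi> \<Phi>'),
      (compose corners \<tau> \<tau>', compose corner_facets \<Psi> \<Psi>'), compose centres \<phi> \<phi>')"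
    using s t by (simp add: eq T_geom_mult bundle_comp_def)
  have "s \<otimes>\<^bsub>T_geom\<^esub> t \<in> carrier T_geom"
    using monoid.m_closed[OF monoid_T_geom] assms T'_geom_carrier by blast
  moreover have "\<sigma>' c \<in> edges" if "c \<in> edges" for c
    using t that bundle_iso_funcset(1)[of \<sigma>' \<Phi>' ArGeom ArGeom] by auto
  ultimately show "s \<otimes>\<^bsub>T_geom\<^esub> t \<in> T'_geom"
    using s t by (simp add: st T'_geom_iff T_geom_carrier compose_eq edge_base_closed)
  have "twist (compose corner_facets \<Psi> \<Psi>') = twist (\<lambda>x. \<Psi> (\<Psi>' x))"
    by (intro twist_cong) (simp add: compose_eq)
  also have "\<dots> = (twist \<Psi> + twist \<Psi>') mod 3"
    using s t by (intro twist_comp) (blast intro: SomGeom_automorphism)+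
  finally show "twist_of (s \<otimes>\<^bsub>T_geom\<^esub> t) = (twist_of s + twist_of t) mod 3"
    unfolding st by (simp add: eq twist_of_def)
qed

lemma T_geom_cancel:
  assumes "z \<in> carrier T_geom" "s \<in> carrier T_geom" "t \<in> carrier T_geom"
    and "z \<otimes>\<^bsub>T_geom\<^esub> s = z \<otimes>\<^bsub>T_geom\<^esub> t"
  shows "s = t"
proof -
  have inv: "group (BijGroup centres)" by (rule group_BijGroup)
  obtain a b p a' b' p' a'' b'' p'' where eq: "z = (a, b, p)" "s = (a', b', p')" "t = (a'', b'', p'')"
    by (metis prod.exhaust)
  with assms have "bundle_comp ArGeom a a' = bundle_comp ArGeom a a''"
    "bundle_comp SomGeom b b' = bundle_comp SomGeom b b''"
    "p \<otimes>\<^bsub>BijGroup centres\<^esub> p' = p \<otimes>\<^bsub>BijGroup centres\<^esub> p''"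
    by (auto simp: T_geom_carrier T_geom_mult BijGroup_def)
  moreover from this have "p' = p''"
    using assms(1-3) monoid.Units_l_cancel[OF group.is_monoid[OF inv], of p p' p''] group.Units_eq[OF inv]
    by (auto simp: eq T_geom_carrier BijGroup_def)
  ultimately show ?thesis
    using assms(1-3) bundle_comp_cancel[of a ArGeom ArGeom a' a'']
      bundle_comp_cancel[of b SomGeom SomGeom b' b''] by (auto simp: eq T_geom_carrier)
qed


section \<open>The subgroup of legal moves\<close>

definition realise :: "move list \<Rightarrow> tgeom" where
  "realise w = ((restrict (turn_cubie w) edges, restrict (turn_facet w) edge_facets),
     (restrict (turn_cubie w) corners, restrict (turn_facet w) corner_facets),
     restrict (turn_cubie w) centres)"

lemma slice_move_realise: "slice_move i v = realise [(i, v)]"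
  by (simp add: slice_move_def realise_def CentGeom_def)

text \<open>The inclusion \<open>\<L> \<subseteq> T'\<close> together with the invariance of the twist.\<close>

lemma realise_T'_geom:
  assumes "legal_word w"
  shows "realise w \<in> T'_geom" "twist_of (realise w) = 0"
proof -
  have "(restrict (turn_cubie w) edges, restrict (turn_facet w) edge_facets) \<in> bundle_iso ArGeom ArGeom"
    using assms by (intro bundle_isoI closed_ArGeom)
      (simp_all add: bij_turn_cubie bij_turn_facet fst_turn_facet fst_geom_facets exchange_edge flip_closed
        turn_facet_flip turn_facet_closed)
  moreover have "(restrict (turn_cubie w) corners, restrict (turn_facet w) corner_facets)
      \<in> bundle_iso SomGeom SomGeom"
    using assms equivariant_turn_facet[OF assms] by (intro bundle_isoI closed_SomGeom)
      (simp_all add: bij_turn_cubie bij_turn_facet fst_turn_facet fst_geom_facets rot_closed equivariant_def)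
  moreover have "restrict (turn_cubie w) centres \<in> Bij centres"
    using assms by (simp add: Bij_def bij_turn_cubie)
  ultimately show "realise w \<in> T'_geom"
    using assms by (simp add: realise_def T'_geom_iff edge_base_closed turn_facet_edge_base)
  have "twist (restrict (turn_facet w) corner_facets) = twist (turn_facet w)"
    by (intro twist_cong) simp
  then show "twist_of (realise w) = 0"
    using twist_turn_facet[OF assms] by (simp add: twist_of_def realise_def)
qed

lemma realise_append:
  assumes "legal_word u" "legal_word w"
  shows "realise (u @ w) = realise u \<otimes>\<^bsub>T_geom\<^esub> realise w"
proof -
  have Bij: "restrict (turn_cubie w) centres \<in> Bij centres" if "legal_word w" for w
    using that by (simp add: Bij_def bij_turn_cubie)
  have cubie: "restrict (turn_cubie (u @ w)) (cubies k) =
      compose (cubies k) (restrict (turn_cubie u) (cubies k)) (restrict (turn_cubie w) (cubies k))" for k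
    using turn_cubie_closed[OF assms(2)] by (auto simp: compose_def)
  have facet: "restrict (turn_facet (u @ w)) (geom_facets (cubies k)) =
      compose (geom_facets (cubies k)) (restrict (turn_facet u) (geom_facets (cubies k)))
        (restrict (turn_facet w) (geom_facets (cubies k)))" for k
    using turn_facet_closed[OF assms(2)] by (auto simp: compose_def)
  show ?thesis
    unfolding realise_def cubie facet T_geom_mult[OF Bij[OF assms(1)] Bij[OF assms(2)]] bundle_comp_def
    by simp
qed

lemma realise_Nil: "realise [] = \<one>\<^bsub>T_geom\<^esub>"
  by (simp add: realise_def T_geom_one bundle_id_def restrict_def fun_eq_iff)

lemma realise_cong:
  assumes "\<And>x. turn_facet u x = turn_facet w x"
  shows "realise u = realise w"
proof -
  have "turn_facet u = turn_facet w" using assms by blast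
  moreover have "turn_cubie u c = turn_cubie w c" for c
    using assms[of "(c, 0)"] fst_turn_facet by (metis fst_conv)
  then have "turn_cubie u = turn_cubie w" by blast
  ultimately show ?thesis unfolding realise_def by metis
qed

lemma realise_Legal:
  assumes "legal_word w"
  shows "realise w \<in> Legal"
  using assms
proof (induction w)
  case Nil
  then show ?case by (simp add: realise_Nil Legal_def generate.one)
next
  case (Cons m w)
  then obtain i v where m: "m = (i, v)" "i \<in> {1, 2, 3}" "v \<in> {-3, -1, 1, 3}"
    by (auto simp: moves_def)
  have "realise [m] \<in> Legal"
    unfolding Legal_def m(1) slice_move_realise[symmetric] using m by (intro generate.incl) blast
  then have "realise [m] \<otimes>\<^bsub>T_geom\<^esub> realise w \<in> Legal"
    using Cons unfolding Legal_def by (intro generate.eng) auto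
  then show ?case
    using Cons.prems realise_append[of "[m]" w] by simp
qed

text \<open>The inverse of a generator is the word consisting of three copies of it.\<close>

lemma Legal_realise:
  assumes "l \<in> Legal"
  shows "\<exists>w. legal_word w \<and> l = realise w"
  using assms unfolding Legal_def
proof (induction rule: generate.induct)
  case one
  then show ?case by (metis realise_Nil empty_subsetI list.set(1))
next
  case (incl h)
  then obtain i v where iv: "i \<in> {1, 2, 3}" "v \<in> {-3, -1, 1, 3}" "h = slice_move i v" by blast
  then have "legal_word [(i, v)]" by (auto simp: moves_def)
  then show ?case using iv slice_move_realise by blast
next
  case (inv h)
  then obtain i v where iv: "i \<in> {1, 2, 3}" "v \<in> {-3, -1, 1, 3}" "h = slice_move i v" by blast
  define m where "m = (i, v)"
  have m: "m \<in> moves" using iv by (auto simp: moves_def m_def)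
  have 4: "realise [m, m, m, m] = \<one>\<^bsub>T_geom\<^esub>"
    using slice_facet_4[OF m] realise_cong[of "[m, m, m, m]" "[]"] realise_Nil by simp
  have "realise [m, m, m] = inv\<^bsub>T_geom\<^esub> h"
  proof (rule monoid.inv_unique'[OF monoid_T_geom])
    show "h \<in> carrier T_geom" "realise [m, m, m] \<in> carrier T_geom"
      using iv m realise_T'_geom(1)[of "[m]"] realise_T'_geom(1)[of "[m, m, m]"]
      by (auto simp: slice_move_realise m_def intro: T'_geom_carrier)
    show "h \<otimes>\<^bsub>T_geom\<^esub> realise [m, m, m] = \<one>\<^bsub>T_geom\<^esub>" "realise [m, m, m] \<otimes>\<^bsub>T_geom\<^esub> h = \<one>\<^bsub>T_geom\<^esub>"
      using 4 m realise_append[of "[m]" "[m, m, m]"] realise_append[of "[m, m, m]" "[m]"] iv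
      by (auto simp: slice_move_realise m_def)
  qed
  moreover have "legal_word [m, m, m]" using m by simp
  ultimately show ?case by metis
next
  case (eng h1 h2)
  then obtain u w where "legal_word u" "legal_word w" "h1 = realise u" "h2 = realise w" by blast
  then show ?case
    using realise_append[of u w] by (intro exI[of _ "u @ w"]) simp
qed


section \<open>The action on colourings\<close>

lemma act_right_mult:
  assumes "s \<in> carrier T_geom" "t \<in> carrier T_geom"
  shows "act_right (act_right x s) t = act_right x (s \<otimes>\<^bsub>T_geom\<^esub> t)"
proof -
  obtain f g h a b p a' b' p' where eq: "x = (f, g, h)" "s = (a, b, p)" "t = (a', b', p')"
    by (metis prod.exhaust)
  have t: "a' \<in> bundle_iso ArGeom ArGeom" "b' \<in> bundle_iso SomGeom SomGeom" "p' \<in> Bij centres" "p \<in> Bij centres"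
    using assms by (auto simp: eq T_geom_carrier)
  then have "p' \<in> centres \<rightarrow> centres" by (auto simp: Bij_def dest: bij_betw_apply)
  then show ?thesis
    using t by (simp add: eq act_right_def T_geom_mult bundle_comp_assoc[symmetric] CentGeom_def compose_assoc)
qed

lemma act_right_inj:
  assumes "x \<in> Rev_marq"
  shows "inj_on (act_right x) (carrier T_geom)"
proof (rule inj_onI)
  fix s t assume st: "s \<in> carrier T_geom" "t \<in> carrier T_geom" "act_right x s = act_right x t"
  obtain f g h a b p a' b' p' where eq: "x = (f, g, h)" "s = (a, b, p)" "t = (a', b', p')"
    by (metis prod.exhaust)
  from assms st have x: "f \<in> bundle_iso ArGeom ArMat" "g \<in> bundle_iso SomGeom SomMat" "bij_betw h centres CentMat"
    and s: "a \<in> bundle_iso ArGeom ArGeom" "b \<in> bundle_iso SomGeom SomGeom" "p \<in> Bij centres"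
    and t: "a' \<in> bundle_iso ArGeom ArGeom" "b' \<in> bundle_iso SomGeom SomGeom" "p' \<in> Bij centres"
    and st': "bundle_comp ArGeom f a = bundle_comp ArGeom f a'" "bundle_comp SomGeom g b = bundle_comp SomGeom g b'"
      "compose centres h p = compose centres h p'"
    by (auto simp: eq Rev_marq_def T_geom_carrier act_right_def CentGeom_def)
  have "p = p'"
  proof (rule extensionalityI)
    show "p \<in> extensional centres" "p' \<in> extensional centres" using s t by (auto simp: Bij_def)
    fix c assume c: "c \<in> centres"
    then have "h (p c) = h (p' c)" using fun_cong[OF st'(3), of c] by (simp add: compose_eq)
    moreover have "p c \<in> centres" "p' c \<in> centres" using c s t by (auto simp: Bij_def dest: bij_betw_apply)
    ultimately show "p c = p' c" using x(3) by (meson bij_betw_imp_inj_on inj_onD)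
  qed
  moreover have "a = a'" "b = b'"
    using bundle_comp_cancel[OF x(1) s(1) t(1) st'(1)] bundle_comp_cancel[OF x(2) s(2) t(2) st'(2)] .
  ultimately show "s = t" by (simp add: eq)
qed

text \<open>This is \<open>(x u x\<^sup>-\<^sup>1) x = x u\<close>: the elements of \<open>\<I>'\<close> act on \<open>x\<close> from the right through
  \<open>T'_geom\<close>.\<close>

lemma act_left_comp_inv:
  assumes x: "x \<in> Rev_marq" and u: "u \<in> carrier T_geom"
  shows "act_left (comp_inv (act_right x u) (rev_inverse x)) x = act_right x u"
proof -
  obtain f g h a b p where eq: "x = (f, g, h)" "u = (a, b, p)" by (metis prod.exhaust)
  from x u have x': "f \<in> bundle_iso ArGeom ArMat" "g \<in> bundle_iso SomGeom SomMat" "bij_betw h centres CentMat"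
    and u': "a \<in> bundle_iso ArGeom ArGeom" "b \<in> bundle_iso SomGeom SomGeom"
    by (auto simp: eq Rev_marq_def T_geom_carrier CentGeom_def)
  have "compose centres (compose CentMat (compose centres h p) (restrict (inv_into centres h) CentMat)) h =
      compose centres h p"
  proof
    fix c
    show "compose centres (compose CentMat (compose centres h p) (restrict (inv_into centres h) CentMat)) h c =
      compose centres h p c"
      using x'(3) by (cases "c \<in> centres") (auto simp: compose_def bij_betw_def inv_into_f_f)
  qed
  then show ?thesis
    using bundle_inv_cancel(1)[OF closed_ArGeom x'(1) bundle_comp_iso[OF closed_ArGeom u'(1) x'(1)]]
      bundle_inv_cancel(1)[OF closed_SomGeom x'(2) bundle_comp_iso[OF closed_SomGeom u'(2) x'(2)]]
    by (simp add: eq act_right_def comp_inv_def rev_inverse_def act_left_def CentGeom_def split: prod.split)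
qed

text \<open>The corner component of an indistinguishable transformation is trivial.\<close>

lemma I'_twist:
  assumes x: "x \<in> Rev_marq" and u: "u \<in> carrier T_geom"
    and "comp_inv (act_right x u) (rev_inverse x) \<in> Indist"
  shows "twist_of u = 0"
proof -
  obtain f g h a b p where eq: "x = (f, g, h)" "u = (a, b, p)" by (metis prod.exhaust)
  from x u have g: "g \<in> bundle_iso SomGeom SomMat" and b: "b \<in> bundle_iso SomGeom SomGeom"
    by (auto simp: eq Rev_marq_def T_geom_carrier)
  have one: "bundle_comp SomMat (bundle_comp SomGeom g b) (bundle_inv SomGeom SomMat g) = bundle_id SomMat"
    using assms(3) by (simp add: eq act_right_def comp_inv_def rev_inverse_def Indist_def bundle_aut_def)
  have "bundle_comp SomGeom g b = bundle_comp SomGeom g (bundle_id SomGeom)"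
    using bundle_inv_cancel(1)[OF closed_SomGeom g bundle_comp_iso[OF closed_SomGeom b g]]
    unfolding one by (simp add: bundle_comp_id[OF g])
  then have "b = bundle_id SomGeom"
    using bundle_comp_cancel[OF g b bundle_id_iso[OF closed_SomGeom]] by blast
  then have "twist_of u = twist (\<lambda>x\<in>corner_facets. x)"
    by (simp add: eq twist_of_def bundle_id_def)
  also have "\<dots> = 0"
    using twist_cong[of "\<lambda>x\<in>corner_facets. x" "turn_facet []"] twist_turn_facet[of "[]"] by simp
  finally show ?thesis .
qed

section \<open>Solvable states\<close>

lemma centre_colour_swap:
  assumes "is_solved_state ((f, F), (g, G), h)" "q \<in> {id, swap a_centre b_centre}" "c \<in> centres"
  shows "fst (h (q c)) = fst (h c)"
proof -
  have "(a_centre, (0, 0, 1)) \<in> geom_facets CentGeom" "(b_centre, (0, 0, 1)) \<in> geom_facets CentGeom"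
    using special_cubies by (simp_all add: geom_facets_def CentGeom_def normals_list dot3_def)
  then have "fst (h a_centre) = col (0, 0, 1)" "fst (h b_centre) = col (0, 0, 1)"
    using assms(1) unfolding is_solved_state_def by blast+
  then show ?thesis
    using assms(2) by (auto simp: Transposition.transpose_def)
qed

text \<open>The word realising \<open>t\<close> up to the transposition \<open>q\<close> of two centres of the same colour is a
  solution: conjugated by \<open>x\<close>, the transposition becomes an element \<open>j\<close> of \<open>\<I>'\<close>.\<close>

lemma solvable_in_orbit:
  assumes solved: "is_solved_state x" and t: "t \<in> T'_geom" "twist_of t = 0"
  shows "act_right x t \<in> solvable_meca x"
proof -
  obtain f F g G h where x: "x = ((f, F), (g, G), h)" by (metis prod.exhaust)
  have marq: "x \<in> Rev_marq" using solved by (auto simp: is_solved_state_def)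
  then have f: "(f, F) \<in> bundle_iso ArGeom ArMat" and g: "(g, G) \<in> bundle_iso SomGeom SomMat"
    and h: "bij_betw h centres CentMat"
    by (auto simp: x Rev_marq_def CentGeom_def)
  obtain \<sigma> \<Phi> \<tau> \<Psi> \<phi> where eq: "t = ((\<sigma>, \<Phi>), (\<tau>, \<Psi>), \<phi>)" by (metis prod.exhaust)
  note t' = t(1)[unfolded eq T'_geom_iff]
  have \<sigma>: "(\<sigma>, \<Phi>) \<in> bundle_iso ArGeom ArGeom" and \<tau>: "(\<tau>, \<Psi>) \<in> bundle_iso SomGeom SomGeom"
    and \<phi>: "\<phi> \<in> extensional centres" "bij_betw \<phi> centres centres"
    using t' by (auto simp: Bij_def)
  note \<sigma>' = bundle_isoD[OF \<sigma>, unfolded ArGeom_simps] and \<tau>' = bundle_isoD[OF \<tau>, unfolded SomGeom_simps]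
  have per: "(\<lambda>c. if c \<in> X then p c else c) permutes X" if "bij_betw p X X" for p :: "int3 \<Rightarrow> int3" and X
  proof -
    have "bij_betw (\<lambda>c. if c \<in> X then p c else c) X X \<longleftrightarrow> bij_betw p X X"
      by (rule bij_betw_cong) simp
    with that show ?thesis
      by (intro bij_imp_permutes) auto
  qed
  obtain w q where w: "legal_word w" and q: "q \<in> {id, swap a_centre b_centre}"
    and edge: "\<forall>c\<in>edges. turn_cubie w c = \<sigma> c" and corner: "\<forall>x\<in>corner_facets. turn_facet w x = \<Psi> x"
    and centre: "\<forall>c\<in>centres. q (turn_cubie w c) = \<phi> c"
    using all_realised[OF per[OF \<sigma>'(2)] per[OF \<phi>(2)] SomGeom_automorphism[OF \<tau>]] t(2)
    by (auto simp: eq twist_of_def)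
  define e :: tgeom where "e = (bundle_id ArGeom, bundle_id SomGeom, restrict q centres)"
  have "q permutes centres"
    using q special_cubies by (auto intro: permutes_swap_id permutes_id)
  then have "restrict q centres \<in> Bij centres"
    by (simp add: Bij_def permutes_imp_bij)
  moreover have "edge_base c \<in> edge_facets" if "c \<in> edges" for c
    using that by (rule edge_base_closed)
  ultimately have e: "e \<in> T'_geom"
    using bundle_id_iso[OF closed_ArGeom] bundle_id_iso[OF closed_SomGeom]
    by (simp add: e_def T'_geom_iff bundle_id_def)
  have "t = e \<otimes>\<^bsub>T_geom\<^esub> realise w"
  proof -
    have "restrict (turn_cubie w) edges = \<sigma>"
      using edge \<sigma>'(1) by (auto simp: restrict_def extensional_def)
    moreover have "restrict (turn_facet w) edge_facets = \<Phi>"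
    proof (rule extensionalityI[OF _ \<sigma>'(3)])
      fix y assume y: "y \<in> edge_facets"
      let ?b = "edge_base (fst y)"
      have c: "fst y \<in> edges" using y by (rule fst_geom_facets)
      have b: "turn_facet w ?b = \<Phi> ?b"
        using t' c edge turn_facet_edge_base[OF w c] by simp
      have bf: "?b \<in> edge_facets" "\<Phi> ?b \<in> edge_facets"
        using edge_base_closed[OF c] bundle_iso_funcset(2)[OF \<sigma>] by (auto simp del: split_paired_All)
      have "\<Phi> (flip ?b) = flip (\<Phi> ?b)"
        using \<sigma>'(6)[OF bf(1)] exchange_edge bf by metis
      then have "turn_facet w (flip ?b) = \<Phi> (flip ?b)"
        using turn_facet_flip[OF w] b by simp
      with b edge_facet_cases[OF y] y show "restrict (turn_facet w) edge_facets y = \<Phi> y"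
        by (metis restrict_apply')
    qed simp
    moreover have "restrict (turn_cubie w) corners = \<tau>"
    proof (rule extensionalityI[OF _ \<tau>'(1)])
      fix c assume c: "c \<in> corners"
      then have "turn_facet w (corner_base c) = \<Psi> (corner_base c)"
        using corner corner_base_closed by blast
      then show "restrict (turn_cubie w) corners c = \<tau> c"
        using c \<tau>'(5)[OF corner_base_closed[OF c]] fst_turn_facet[of w "corner_base c"] by simp
    qed simp
    moreover have "restrict (turn_facet w) corner_facets = \<Psi>"
      using corner \<tau>'(3) by (auto simp: restrict_def extensional_def)
    moreover have "compose centres (restrict q centres) (restrict (turn_cubie w) centres) = \<phi>"
      using centre \<phi>(1) turn_cubie_closed[OF w]
      by (auto simp: compose_def restrict_def extensional_def)
    moreover have "restrict (turn_cubie w) centres \<in> Bij centres"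
      using w by (simp add: Bij_def bij_turn_cubie)
    ultimately show ?thesis
      using \<open>restrict q centres \<in> Bij centres\<close> bundle_comp_id(2)[OF \<sigma>] bundle_comp_id(2)[OF \<tau>]
      by (simp add: eq e_def realise_def T_geom_mult)
  qed
  moreover define j where "j = comp_inv (act_right x e) (rev_inverse x)"
  moreover have "j \<in> I' x"
  proof -
    let ?p = "compose CentMat (compose centres h (restrict q centres)) (restrict (inv_into centres h) CentMat)"
    have j: "j = (bundle_id ArMat, bundle_id SomMat, ?p)"
      using bundle_inv_cancel(2)[OF closed_ArGeom f] bundle_inv_cancel(2)[OF closed_SomGeom g]
        bundle_comp_id(1)[OF f] bundle_comp_id(1)[OF g]
      by (simp add: j_def x e_def act_right_def comp_inv_def rev_inverse_def CentGeom_def split: prod.split)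
    have "bundle_id ArMat \<in> I_Ar"
    proof -
      have "bundle_id ArMat \<in> carrier (bundle_aut ArMat)"
        using bundle_id_iso[OF closed_bundle_iso[OF closed_ArGeom f]] by (simp add: bundle_aut_def)
      then show ?thesis by (auto simp: I_Ar_def bundle_id_def)
    qed
    moreover have "?p \<in> I_Cent"
    proof -
      have "bij_betw (compose centres h (restrict q centres)) centres CentMat"
        using \<open>restrict q centres \<in> Bij centres\<close> h by (auto simp: Bij_def intro: bij_betw_compose)
      moreover have "bij_betw (restrict (inv_into centres h) CentMat) CentMat centres"
        using h by (simp add: bij_betw_inv_into)
      ultimately have "bij_betw ?p CentMat CentMat"
        by (rule bij_betw_compose[rotated])
      then have "?p \<in> carrier (BijGroup CentMat)"
        by (simp add: BijGroup_def Bij_def)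
      moreover have "fst (?p y) = fst y" if y: "y \<in> CentMat" for y
      proof -
        have "inv_into centres h y \<in> centres" "h (inv_into centres h y) = y"
          using h y by (auto simp: bij_betw_def inv_into_into f_inv_into_f)
        then show ?thesis
          using y centre_colour_swap[OF solved[unfolded x] q] by (simp add: compose_eq)
      qed
      ultimately show ?thesis by (simp add: I_Cent_def)
    qed
    ultimately have "j \<in> Indist"
      by (simp add: j Indist_def bundle_aut_def)
    then show ?thesis
      using e unfolding I'_def j_def by blast
  qed
  moreover have "act_right x t = act_right (act_left j x) (realise w)"
    using calculation act_left_comp_inv[OF marq T'_geom_carrier[OF e]]
      act_right_mult[OF T'_geom_carrier[OF e] T'_geom_carrier[OF realise_T'_geom(1)[OF w]]] by simp
  ultimately show ?thesis
    using realise_Legal[OF w] unfolding solvable_meca_def by blast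
qed

lemma solvable_meca_eq:
  assumes "is_solved_state x"
  shows "solvable_meca x = act_right x ` {t \<in> T'_geom. twist_of t = 0}"
proof
  have marq: "x \<in> Rev_marq" using assms by (auto simp: is_solved_state_def)
  show "solvable_meca x \<subseteq> act_right x ` {t \<in> T'_geom. twist_of t = 0}"
  proof
    fix y assume "y \<in> solvable_meca x"
    then obtain j l where j: "j \<in> I' x" and l: "l \<in> Legal" and y: "y = act_right (act_left j x) l"
      unfolding solvable_meca_def by blast
    from j obtain u where u: "u \<in> T'_geom" "j = comp_inv (act_right x u) (rev_inverse x)" "j \<in> Indist"
      unfolding I'_def by blast
    obtain w where w: "legal_word w" "l = realise w" using Legal_realise[OF l] by blast
    note lT = realise_T'_geom[OF w(1)]
    have "y = act_right x (u \<otimes>\<^bsub>T_geom\<^esub> l)"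
      using y u w lT act_left_comp_inv[OF marq] act_right_mult T'_geom_carrier by metis
    moreover have "twist_of u = 0"
      using I'_twist[OF marq T'_geom_carrier[OF u(1)]] u by blast
    then have "twist_of (u \<otimes>\<^bsub>T_geom\<^esub> l) = 0" "u \<otimes>\<^bsub>T_geom\<^esub> l \<in> T'_geom"
      using T'_geom_mult[OF u(1) lT(1)] lT(2) w(2) by auto
    ultimately show "y \<in> act_right x ` {t \<in> T'_geom. twist_of t = 0}" by blast
  qed
qed (use solvable_in_orbit[OF assms] in blast)


section \<open>Counting\<close>

text \<open>A single turned corner, which has twist 1; multiplication by it permutes the three classes of
  \<open>T'_geom\<close> cyclically.\<close>

definition corner_turn :: tgeom where
  "corner_turn = (bundle_id ArGeom,
     ((\<lambda>c\<in>corners. c), (\<lambda>x\<in>corner_facets. if fst x = (3, 3, 3) then rot x else x)),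
     \<lambda>c\<in>centres. c)"

lemma corner_turn: "corner_turn \<in> T'_geom" "twist_of corner_turn = 1"
proof -
  let ?Z = "\<lambda>x. if fst x = (3, 3, 3) then rot x else x"
  have *: "rot (rot (rot x)) = x \<and> rot x \<in> corner_facets \<and> rot (rot x) \<in> corner_facets"
    if "x \<in> corner_facets" for x
    using that by (simp add: rot_3 rot_closed)
  have "bij_betw ?Z corner_facets corner_facets"
    by (rule bij_betw_byWitness[where f' = "\<lambda>x. if fst x = (3, 3, 3) then rot (rot x) else x"])
      (use * in \<open>simp_all add: image_subset_iff\<close>)
  moreover have "bij_betw (\<lambda>c. c) corners corners"
    using bij_betw_id[of corners] by (simp only: id_def)
  ultimately have "((\<lambda>c\<in>corners. c), restrict ?Z corner_facets) \<in> bundle_iso SomGeom SomGeom"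
    by (intro bundle_isoI closed_SomGeom) (simp_all add: rot_closed fst_geom_facets)
  moreover have "(\<lambda>c\<in>centres. c) \<in> Bij centres"
    by (auto simp: Bij_def bij_betw_def inj_on_def)
  ultimately show "corner_turn \<in> T'_geom"
    using bundle_id_iso[OF closed_ArGeom]
    by (simp add: corner_turn_def T'_geom_iff bundle_id_def edge_base_closed)
  have "height (?Z (corner_base c)) = (if c = (3, 3, 3) then 1 else 0)" if "c \<in> corners" for c
    using height_rot[OF corner_base_closed[OF that]] by auto
  then have "twist ?Z = 1"
    using special_cubies(7) unfolding twist_def by (simp cong: sum.cong)
  moreover have "twist (restrict ?Z corner_facets) = twist ?Z"
    by (intro twist_cong) simp
  ultimately show "twist_of corner_turn = 1"
    by (simp add: twist_of_def corner_turn_def)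
qed

lemma finite_T'_geom: "finite T'_geom"
proof (rule finite_subset)
  show "T'_geom \<subseteq> bundle_iso ArGeom ArGeom \<times> bundle_iso SomGeom SomGeom \<times> (centres \<rightarrow>\<^sub>E centres)"
  proof
    fix t assume "t \<in> T'_geom"
    then have "t \<in> carrier T_geom" by (rule T'_geom_carrier)
    then show "t \<in> bundle_iso ArGeom ArGeom \<times> bundle_iso SomGeom SomGeom \<times> (centres \<rightarrow>\<^sub>E centres)"
      by (cases t) (auto simp: T_geom_carrier Bij_def PiE_def dest: bij_betw_apply)
  qed
  show "finite (bundle_iso ArGeom ArGeom \<times> bundle_iso SomGeom SomGeom \<times> (centres \<rightarrow>\<^sub>E centres))"
    by (intro finite_cartesian_product finite_bundle_iso finite_PiE) auto
qed

lemma card_T'_geom: "card T'_geom = 3 * card {t \<in> T'_geom. twist_of t = 0}"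
proof -
  let ?K = "\<lambda>i. {t \<in> T'_geom. twist_of t = i}"
  have fin: "finite (?K i)" for i using finite_T'_geom by simp
  have le: "card (?K i) \<le> card (?K ((i + 1) mod 3))" for i
  proof (rule card_inj_on_le[OF _ _ fin])
    show "inj_on (\<lambda>t. corner_turn \<otimes>\<^bsub>T_geom\<^esub> t) (?K i)"
      using T_geom_cancel T'_geom_carrier corner_turn(1) by (blast intro: inj_onI)
    show "(\<lambda>t. corner_turn \<otimes>\<^bsub>T_geom\<^esub> t) ` ?K i \<subseteq> ?K ((i + 1) mod 3)"
      using T'_geom_mult[OF corner_turn(1)] corner_turn(2) by (auto simp: add.commute)
  qed
  have eq: "card (?K 1) = card (?K 0)" "card (?K 2) = card (?K 0)"
    using le[of 0] le[of 1] le[of 2] by auto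
  have "twist_of t \<in> {0, 1, 2}" for t
    unfolding twist_of_def twist_def by (auto; presburger)
  then have "T'_geom = ?K 0 \<union> (?K 1 \<union> ?K 2)" by blast
  then have "card T'_geom = card (?K 0 \<union> (?K 1 \<union> ?K 2))" by simp
  also have "\<dots> = card (?K 0) + (card (?K 1) + card (?K 2))"
  proof -
    have "card (?K 1 \<union> ?K 2) = card (?K 1) + card (?K 2)"
      by (rule card_Un_disjoint[OF fin fin]) auto
    moreover have "card (?K 0 \<union> (?K 1 \<union> ?K 2)) = card (?K 0) + card (?K 1 \<union> ?K 2)"
      by (rule card_Un_disjoint[OF fin finite_UnI[OF fin fin]]) auto
    ultimately show ?thesis by simp
  qed
  finally show ?thesis using eq by simp
qed

theorem mainTheorem4:
  fixes x0 :: rev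
  assumes "is_solved_state x0"
  shows "measure_pmf.prob (pmf_of_set (Rev_meca x0)) (solvable_meca x0) =
           real (card (solvable_meca x0)) / real (card (Rev_meca x0)) \<and>
         real (card (solvable_meca x0)) / real (card (Rev_meca x0)) = 1 / 3"
proof -
  have "x0 \<in> Rev_marq" using assms by (auto simp: is_solved_state_def)
  then have inj: "inj_on (act_right x0) T'_geom"
    using act_right_inj T'_geom_carrier by (blast intro: inj_on_subset)
  have meca: "Rev_meca x0 = act_right x0 ` T'_geom"
    unfolding Rev_meca_def by blast
  note solv = solvable_meca_eq[OF assms]
  have fin: "finite (Rev_meca x0)" using finite_T'_geom by (simp add: meca)
  have ne: "Rev_meca x0 \<noteq> {}" using corner_turn(1) unfolding meca by blast
  have "card (Rev_meca x0) = card T'_geom"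
    using inj by (simp add: meca card_image)
  moreover have "card (solvable_meca x0) = card {t \<in> T'_geom. twist_of t = 0}"
    unfolding solv by (rule card_image) (rule inj_on_subset[OF inj], blast)
  ultimately have "card (Rev_meca x0) = 3 * card (solvable_meca x0)"
    using card_T'_geom by simp
  moreover have "card (Rev_meca x0) \<noteq> 0" using fin ne by simp
  moreover have "Rev_meca x0 \<inter> solvable_meca x0 = solvable_meca x0"
    unfolding meca solv by blast
  ultimately show ?thesis
    using measure_pmf_of_set[OF ne fin, of "solvable_meca x0"] by simp
qed

end
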